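(* Let $\pi:\hat G\to C_2=\{1,-1\}$ be a surjective homomorphism from a finite group with kernel $G$, let $\hat\theta$ be a $\pi$-twisted $2$-cocycle on $\hat G$ with restriction $\theta$ to $G$, and let $\lambda:\hat G\to U(1)$ be a character. Write $(P,\Theta)=(P^{(\hat\theta,\lambda)},\Theta^{(\hat\theta,\lambda)})$. For each $V\in\mathrm{Rep}^\theta(G)$ and $\phi\in\mathrm{Hom}_G(V,V)$, let $\iota_\phi:\mathrm{Hom}_G(V,P(V))\to\mathrm{Hom}_G(V,P(V))$ be the linear map $f\mapsto P(f)\circ\Theta_V\circ\phi$. Then $$\mathrm{tr}_{\mathrm{Hom}_G(V,P(V))}\,\iota_\phi=\langle\tau^V(\phi),\nu_{(\hat\theta,\lambda)}\rangle_G.$$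
   Context: All vector spaces are finite dimensional over $\mathbb C$; $V^\vee$ is the linear dual, $f^\vee$ the dual map, $\mathrm{ev}_V:V\to V^{\vee\vee}$ evaluation. A $\pi$-twisted $2$-cocycle is $\hat\theta:\hat G\times\hat G\to U(1)$, $(\omega_2,\omega_1)\mapsto\hat\theta([\omega_2|\omega_1])$, equal to $1$ if either argument is $e$, with $\hat\theta([\omega_2|\omega_1])^{\pi(\omega_3)}\,\hat\theta([\omega_3|\omega_2\omega_1])=\hat\theta([\omega_3\omega_2|\omega_1])\,\hat\theta([\omega_3|\omega_2])$. A $\theta$-twisted representation of $G$ is a vector space $V$ with $\rho_V:G\to GL(V)$, $\rho_V(e)=\mathrm{id}_V$, $\rho_V(g_2)\rho_V(g_1)=\theta([g_2|g_1])\rho_V(g_2g_1)$; $\mathrm{Rep}^\theta(G)$ is the category of these with $G$-equivariant linear maps $\mathrm{Hom}_G$. For $g\in G$, $\omega\in\hat G$ put $\mathsf T([\omega]g)=\hat\theta([g^{-1}|g])^{\frac{\pi(\omega)-1}{2}}\,\frac{\hat\theta([\omega g^{\pi(\omega)}\omega^{-1}|\omega])}{\hat\theta([\omega|g^{\pi(\omega)}])}$. Fix any $\varsigma\in\hat G\setminus G$. The contravariant functor $P$ on $\mathrm{Rep}^\theta(G)$ is $P(V,\rho)=(V^\vee,\rho^P)$, $\rho^P(g)=\frac{\lambda(g)}{\mathsf T([\varsigma]g)}\rho(\varsigma g^{-1}\varsigma^{-1})^\vee$, $P(f)=f^\vee$, and $\Theta_V=\frac{\lambda(\varsigma)}{\hat\theta([\varsigma|\varsigma])}\,\mathrm{ev}_V\circ\rho(\varsigma^2)^{-1}:V\to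 P(P(V))$. Up to equivalence $(P,\Theta)$ does not depend on $\varsigma$. $\mathbb C^{\theta^{-1}}[G]$ has basis $\{l_g\}_{g\in G}$ and product $l_{g_2}l_{g_1}=\theta([g_2|g_1])^{-1}l_{g_2g_1}$, and centre $Z(\mathbb C^{\theta^{-1}}[G])$; $\langle\sum_ga_gl_g,\sum_hb_hl_h\rangle_G=\frac1{|G|}\sum_{g\in G}\theta([g^{-1}|g])^{-1}a_{g^{-1}}b_g$; $\nu_{(\hat\theta,\lambda)}=\sum_{\varsigma\in\hat G\setminus G}\frac{\lambda(\varsigma)}{\hat\theta([\varsigma|\varsigma])}l_{\varsigma^2}$; and $\tau^V:\mathrm{Hom}_G(V,V)\to Z(\mathbb C^{\theta^{-1}}[G])$ is $\tau^V(\phi)=\sum_{g\in G}\mathrm{tr}_V(\phi\circ\rho_V(g))\,l_g$.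
   Formalization: With P formed at ς, Θ_V is taken with ς⁻¹ in place of ς: Θ_V = λ(ς⁻¹)/θ̂([ς⁻¹|ς⁻¹]) ev_V∘ρ(ς⁻²)⁻¹; as printed, Θ_V need not be G-equivariant (Ĝ=S₃×C₂, ς=(3-cycle,−1)) and ι_φ need not preserve Hom_G(V,P(V)). *)

theory Defs
  imports Complex_Main "HOL-Library.Function_Algebras" "HOL-Algebra.Coset"
begin

section \<open>Complex vector spaces\<close>

text \<open>A vector space is a linear subspace of a type of class \<open>complex_vector\<close>. Functions form such
  a type with the pointwise structure, so that dual spaces, double duals and spaces of linear maps
  are again vector spaces in this sense.\<close>

class complex_vector = ab_group_add +
  fixes scaleC :: "complex \<Rightarrow> 'a \<Rightarrow> 'a" (infixr \<open>*\<^sub>C\<close> 75)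
  assumes scaleC_add_right: "a *\<^sub>C (x + y) = a *\<^sub>C x + a *\<^sub>C y"
    and scaleC_add_left: "(a + b) *\<^sub>C x = a *\<^sub>C x + b *\<^sub>C x"
    and scaleC_scaleC: "a *\<^sub>C b *\<^sub>C x = (a * b) *\<^sub>C x"
    and scaleC_one: "1 *\<^sub>C x = x"

instantiation complex :: complex_vector
begin
definition scaleC_complex_def: "a *\<^sub>C (x :: complex) = a * x"
instance by standard (auto simp: scaleC_complex_def algebra_simps)
end

instantiation "fun" :: (type, complex_vector) complex_vector
begin
definition scaleC_fun_def: "a *\<^sub>C f = (\<lambda>x. a *\<^sub>C f x)"
instance
  by standard
    (auto simp: scaleC_fun_def fun_eq_iff scaleC_add_right scaleC_add_left scaleC_scaleC scaleC_one)
end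

global_interpretation complex_vector: vector_space "scaleC :: complex \<Rightarrow> 'a \<Rightarrow> 'a::complex_vector"
  by standard (simp_all add: scaleC_add_right scaleC_add_left scaleC_scaleC scaleC_one)

definition fin_dim_space :: "'v::complex_vector set \<Rightarrow> bool" where
  "fin_dim_space V \<longleftrightarrow>
     complex_vector.subspace V \<and> (\<exists>B. finite B \<and> complex_vector.span B = V)"

text \<open>A map with domain \<open>V\<close> is represented by the function that agrees with it on \<open>V\<close> and vanishes
  off \<open>V\<close>. Composites of such linear maps are plain composites of functions.\<close>

definition ext0 :: "'a set \<Rightarrow> ('a \<Rightarrow> 'b::zero) \<Rightarrow> 'a \<Rightarrow> 'b" where
  "ext0 A f = (\<lambda>x. if x \<in> A then f x else 0)"

definition lin_maps :: "'v::complex_vector set \<Rightarrow> 'w::complex_vector set \<Rightarrow> ('v \<Rightarrow> 'w) set" where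
  "lin_maps V W =
     {f. (\<forall>x\<in>V. f x \<in> W) \<and> (\<forall>x\<in>V. \<forall>y\<in>V. f (x + y) = f x + f y) \<and>
         (\<forall>c. \<forall>x\<in>V. f (c *\<^sub>C x) = c *\<^sub>C f x) \<and> (\<forall>x. x \<notin> V \<longrightarrow> f x = 0)}"

definition general_linear :: "'v::complex_vector set \<Rightarrow> ('v \<Rightarrow> 'v) set" where
  "general_linear V = {f \<in> lin_maps V V. bij_betw f V V}"

definition lin_id :: "'v::complex_vector set \<Rightarrow> 'v \<Rightarrow> 'v" where
  "lin_id V = ext0 V (\<lambda>x. x)"

definition lin_inv :: "'v::complex_vector set \<Rightarrow> ('v \<Rightarrow> 'v) \<Rightarrow> 'v \<Rightarrow> 'v" where
  "lin_inv V f = ext0 V (inv_into V f)"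

text \<open>The trace is computed in an arbitrarily chosen basis of \<open>V\<close>.\<close>

definition lin_trace :: "'v::complex_vector set \<Rightarrow> ('v \<Rightarrow> 'v) \<Rightarrow> complex" where
  "lin_trace V f =
     (let B = (SOME B. B \<subseteq> V \<and> complex_vector.independent B \<and> complex_vector.span B = V)
      in \<Sum>b\<in>B. complex_vector.representation B (f b) b)"

definition dual :: "'v::complex_vector set \<Rightarrow> ('v \<Rightarrow> complex) set" where
  "dual V = lin_maps V UNIV"

definition dual_map ::
  "'w::complex_vector set \<Rightarrow> ('v \<Rightarrow> 'w) \<Rightarrow> ('w \<Rightarrow> complex) \<Rightarrow> 'v::complex_vector \<Rightarrow> complex" where
  "dual_map W f = ext0 (dual W) (\<lambda>\<alpha>. \<alpha> \<circ> f)" \<comment> \<open>the dual of \<open>f \<in> lin_maps V W\<close>\<close>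

definition ev :: "'v::complex_vector set \<Rightarrow> 'v \<Rightarrow> ('v \<Rightarrow> complex) \<Rightarrow> complex" where
  "ev V = ext0 V (\<lambda>v. ext0 (dual V) (\<lambda>\<alpha>. \<alpha> v))"


section \<open>Twisted cocycles and twisted representations\<close>

definition C2 :: "int monoid" where
  "C2 = \<lparr>carrier = {1, -1}, mult = (*), one = 1\<rparr>"

definition U1 :: "complex monoid" where
  "U1 = \<lparr>carrier = {z. cmod z = 1}, mult = (*), one = 1\<rparr>"

definition ker_group :: "('g, 'm) monoid_scheme \<Rightarrow> ('g \<Rightarrow> int) \<Rightarrow> ('g, 'm) monoid_scheme" where
  "ker_group Gh \<pi> = Gh\<lparr>carrier := kernel Gh C2 \<pi>\<rparr>"

text \<open>A cochain value written \<open>\<theta>([b|a])\<close> on paper is \<open>\<theta> b a\<close> here.\<close>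

definition twisted_cocycle ::
  "('g, 'm) monoid_scheme \<Rightarrow> ('g \<Rightarrow> int) \<Rightarrow> ('g \<Rightarrow> 'g \<Rightarrow> complex) \<Rightarrow> bool" where
  "twisted_cocycle Gh \<pi> \<theta> \<longleftrightarrow>
     (\<forall>b\<in>carrier Gh. \<forall>a\<in>carrier Gh. \<theta> b a \<in> carrier U1) \<and>
     (\<forall>a\<in>carrier Gh. \<theta> a \<one>\<^bsub>Gh\<^esub> = 1 \<and> \<theta> \<one>\<^bsub>Gh\<^esub> a = 1) \<and>
     (\<forall>c\<in>carrier Gh. \<forall>b\<in>carrier Gh. \<forall>a\<in>carrier Gh.
        \<theta> b a powi \<pi> c * \<theta> c (b \<otimes>\<^bsub>Gh\<^esub> a) = \<theta> (c \<otimes>\<^bsub>Gh\<^esub> b) a * \<theta> c b)"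

type_synonym ('g, 'v) rep = "'v set \<times> ('g \<Rightarrow> 'v \<Rightarrow> 'v)"

fun twisted_rep ::
  "('g, 'm) monoid_scheme \<Rightarrow> ('g \<Rightarrow> 'g \<Rightarrow> complex) \<Rightarrow> ('g, 'v::complex_vector) rep \<Rightarrow> bool" where
  "twisted_rep G \<theta> (V, \<rho>) \<longleftrightarrow>
     fin_dim_space V \<and> (\<forall>g\<in>carrier G. \<rho> g \<in> general_linear V) \<and> \<rho> \<one>\<^bsub>G\<^esub> = lin_id V \<and>
     (\<forall>h\<in>carrier G. \<forall>g\<in>carrier G. \<rho> h \<circ> \<rho> g = \<theta> h g *\<^sub>C \<rho> (h \<otimes>\<^bsub>G\<^esub> g))"

fun rep_hom ::
  "('g, 'm) monoid_scheme \<Rightarrow> ('g, 'v::complex_vector) rep \<Rightarrow> ('g, 'w::complex_vector) rep \<Rightarrow>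
   ('v \<Rightarrow> 'w) set" where
  "rep_hom G (V, \<rho>) (W, \<sigma>) = {f \<in> lin_maps V W. \<forall>g\<in>carrier G. f \<circ> \<rho> g = \<sigma> g \<circ> f}"


section \<open>The duality structure\<close>

definition loop_trans ::
  "('g, 'm) monoid_scheme \<Rightarrow> ('g \<Rightarrow> int) \<Rightarrow> ('g \<Rightarrow> 'g \<Rightarrow> complex) \<Rightarrow> 'g \<Rightarrow> 'g \<Rightarrow> complex" where
  "loop_trans Gh \<pi> \<theta> \<omega> g =
     \<theta> (inv\<^bsub>Gh\<^esub> g) g powi ((\<pi> \<omega> - 1) div 2) *
     (\<theta> (\<omega> \<otimes>\<^bsub>Gh\<^esub> (g [^]\<^bsub>Gh\<^esub> \<pi> \<omega>) \<otimes>\<^bsub>Gh\<^esub> inv\<^bsub>Gh\<^esub> \<omega>) \<omega> / \<theta> \<omega> (g [^]\<^bsub>Gh\<^esub> \<pi> \<omega>))"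

fun dual_rep ::
  "('g, 'm) monoid_scheme \<Rightarrow> ('g \<Rightarrow> int) \<Rightarrow> ('g \<Rightarrow> 'g \<Rightarrow> complex) \<Rightarrow> ('g \<Rightarrow> complex) \<Rightarrow> 'g \<Rightarrow>
   ('g, 'v::complex_vector) rep \<Rightarrow> ('g, 'v \<Rightarrow> complex) rep" where
  "dual_rep Gh \<pi> \<theta> \<chi> s (V, \<rho>) =
     (dual V, \<lambda>g. (\<chi> g / loop_trans Gh \<pi> \<theta> s g) *\<^sub>C
                    dual_map V (\<rho> (s \<otimes>\<^bsub>Gh\<^esub> inv\<^bsub>Gh\<^esub> g \<otimes>\<^bsub>Gh\<^esub> inv\<^bsub>Gh\<^esub> s)))"

text \<open>The map \<open>\<Theta>\<close> from \<open>V\<close> to its double dual that accompanies \<^term>\<open>dual_rep Gh \<pi> \<theta> \<chi> s\<close>. It is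
  \<open>\<chi> t / \<theta> t t\<close> times \<open>ev \<circ> \<rho> (t\<^sup>2)\<^sup>-\<^sup>1\<close> at \<open>t = s\<^sup>-\<^sup>1\<close>, not at \<open>t = s\<close>: the double dual representation
  is, up to scalars, \<open>g \<mapsto> \<rho> (s\<^sup>2 g s\<^sup>-\<^sup>2)\<close>, and it is \<open>\<rho> (s\<^sup>-\<^sup>2)\<^sup>-\<^sup>1\<close>, proportional to \<open>\<rho> (s\<^sup>2)\<close>, that
  intertwines \<open>\<rho>\<close> with it, whereas \<open>\<rho> (s\<^sup>2)\<^sup>-\<^sup>1\<close> in general does not.\<close>

fun double_dual_map ::
  "('g, 'm) monoid_scheme \<Rightarrow> ('g \<Rightarrow> 'g \<Rightarrow> complex) \<Rightarrow> ('g \<Rightarrow> complex) \<Rightarrow> 'g \<Rightarrow>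
   ('g, 'v::complex_vector) rep \<Rightarrow> 'v \<Rightarrow> ('v \<Rightarrow> complex) \<Rightarrow> complex" where
  "double_dual_map Gh \<theta> \<chi> s (V, \<rho>) =
     (let t = inv\<^bsub>Gh\<^esub> s
      in (\<chi> t / \<theta> t t) *\<^sub>C (ev V \<circ> lin_inv V (\<rho> (t \<otimes>\<^bsub>Gh\<^esub> t))))"

text \<open>\<open>f \<mapsto> P(f) \<circ> \<Theta>\<^sub>V \<circ> \<phi>\<close>, where \<open>P(f)\<close> is the dual of \<open>f : V \<rightarrow> P(V)\<close>.\<close>

definition iota ::
  "('g, 'm) monoid_scheme \<Rightarrow> ('g \<Rightarrow> 'g \<Rightarrow> complex) \<Rightarrow> ('g \<Rightarrow> complex) \<Rightarrow> 'g \<Rightarrow>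
   ('g, 'v::complex_vector) rep \<Rightarrow> ('v \<Rightarrow> 'v) \<Rightarrow> ('v \<Rightarrow> 'v \<Rightarrow> complex) \<Rightarrow> 'v \<Rightarrow> 'v \<Rightarrow> complex" where
  "iota Gh \<theta> \<chi> s X \<phi> f = dual_map (dual (fst X)) f \<circ> double_dual_map Gh \<theta> \<chi> s X \<circ> \<phi>"


section \<open>The twisted group algebra\<close>

text \<open>An element of the twisted group algebra is given by its coefficient function, which is
  supported on the group.\<close>

definition basis_elt :: "'g \<Rightarrow> 'g \<Rightarrow> complex" where
  "basis_elt g = (\<lambda>h. if h = g then 1 else 0)"

definition pairing ::
  "('g, 'm) monoid_scheme \<Rightarrow> ('g \<Rightarrow> 'g \<Rightarrow> complex) \<Rightarrow> ('g \<Rightarrow> complex) \<Rightarrow> ('g \<Rightarrow> complex) \<Rightarrow> complex" where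
  "pairing G \<theta> a b =
     1 / of_nat (card (carrier G)) *
     (\<Sum>g\<in>carrier G. inverse (\<theta> (inv\<^bsub>G\<^esub> g) g) * a (inv\<^bsub>G\<^esub> g) * b g)"

definition nu_elt ::
  "('g, 'm) monoid_scheme \<Rightarrow> ('g \<Rightarrow> int) \<Rightarrow> ('g \<Rightarrow> 'g \<Rightarrow> complex) \<Rightarrow> ('g \<Rightarrow> complex) \<Rightarrow> 'g \<Rightarrow> complex" where
  "nu_elt Gh \<pi> \<theta> \<chi> =
     (\<Sum>s\<in>carrier Gh - carrier (ker_group Gh \<pi>). (\<chi> s / \<theta> s s) *\<^sub>C basis_elt (s \<otimes>\<^bsub>Gh\<^esub> s))"

fun tau_elt ::
  "('g, 'm) monoid_scheme \<Rightarrow> ('g, 'v::complex_vector) rep \<Rightarrow> ('v \<Rightarrow> 'v) \<Rightarrow> 'g \<Rightarrow> complex" where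
  "tau_elt G (V, \<rho>) \<phi> = (\<Sum>g\<in>carrier G. lin_trace V (\<phi> \<circ> \<rho> g) *\<^sub>C basis_elt g)"

end

theory Submission
  imports Defs
begin

text \<open>A map \<open>f : V \<rightarrow> P(V)\<close> is a bilinear form \<open>C v w = f(v)(w)\<close> on \<open>V\<close>, and \<open>G\<close>-equivariance says that \<open>C\<close>
  is fixed by the operators \<open>C \<mapsto> wt g * C (\<rho> g v) (\<rho> (s g s\<^sup>-\<^sup>1) w)\<close>, which the twisted cocycle condition
  makes into an action of \<open>G\<close>. In these terms \<open>\<iota>\<close> is a multiple of \<open>C v w \<mapsto> C w (\<rho> (s\<^sup>2) (\<phi> v))\<close>. Composing
  it with the averaging projection onto the fixed forms, and using that \<open>C v w \<mapsto> C (X w) (Y v)\<close> has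
  trace \<open>tr (X Y)\<close> on all forms, gives a sum over \<open>g \<in> G\<close> of multiples of \<open>tr (\<phi> \<rho> ((g s)\<^sup>2))\<close>. The cocycle
  condition identifies the scalars, and the substitution \<open>\<varsigma> = (g s)\<^sup>-\<^sup>1\<close> turns the sum into the pairing.\<close>

section \<open>Traces and bilinear forms\<close>

text \<open>Maps here are linear only on a subspace \<open>W\<close> of the ambient type, so the
  induction also has to check that every partial sum stays in \<open>W\<close>.\<close>

lemma linear_on_sum:
  fixes f :: "'v::complex_vector \<Rightarrow> 'w::complex_vector"
  assumes W: "complex_vector.subspace W"
    and add: "\<And>x y. x \<in> W \<Longrightarrow> y \<in> W \<Longrightarrow> f (x + y) = f x + f y"
    and scale: "\<And>c x. x \<in> W \<Longrightarrow> f (c *\<^sub>C x) = c *\<^sub>C f x"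
    and x: "\<And>k. k \<in> K \<Longrightarrow> x k \<in> W"
  shows "f (\<Sum>k\<in>K. c k *\<^sub>C x k) = (\<Sum>k\<in>K. c k *\<^sub>C f (x k))"
proof -
  have "f 0 = f 0 + f 0"
    using add[of 0 0] complex_vector.subspace_0[OF W] by simp
  then have zero: "f 0 = 0" by simp
  show ?thesis
    using x
  proof (induction K rule: infinite_finite_induct)
    case (insert k K)
    have "(\<Sum>k\<in>K. c k *\<^sub>C x k) \<in> W"
      using insert.prems by (intro complex_vector.subspace_sum[OF W] complex_vector.subspace_scale[OF W]) auto
    moreover have "c k *\<^sub>C x k \<in> W"
      using insert.prems by (intro complex_vector.subspace_scale[OF W]) auto
    ultimately show ?case
      using insert by (simp add: add scale)
  qed (simp_all add: zero)
qed

text \<open>The expansion of \<open>y\<close> writes the identity of \<open>W\<close> as a sum of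
  rank-one maps, and the trace of \<open>f\<close> composed with a rank-one map is one value of its
  functional. The vectors \<open>x k\<close> may be linearly dependent; this matters later, where
  averaged forms span a space without being a basis of it.\<close>

lemma lin_trace_frame:
  fixes W :: "'v::complex_vector set" and x :: "'k \<Rightarrow> 'v" and \<xi> :: "'k \<Rightarrow> 'v \<Rightarrow> complex"
  assumes W: "complex_vector.subspace W" and K: "finite K"
    and x: "\<And>k. k \<in> K \<Longrightarrow> x k \<in> W"
    and \<xi>_add: "\<And>k y z. k \<in> K \<Longrightarrow> y \<in> W \<Longrightarrow> z \<in> W \<Longrightarrow> \<xi> k (y + z) = \<xi> k y + \<xi> k z"
    and \<xi>_scale: "\<And>k c y. k \<in> K \<Longrightarrow> y \<in> W \<Longrightarrow> \<xi> k (c *\<^sub>C y) = c * \<xi> k y"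
    and frame: "\<And>y. y \<in> W \<Longrightarrow> y = (\<Sum>k\<in>K. \<xi> k y *\<^sub>C x k)"
    and f: "\<And>y. y \<in> W \<Longrightarrow> f y \<in> W"
    and f_add: "\<And>y z. y \<in> W \<Longrightarrow> z \<in> W \<Longrightarrow> f (y + z) = f y + f z"
    and f_scale: "\<And>c y. y \<in> W \<Longrightarrow> f (c *\<^sub>C y) = c *\<^sub>C f y"
  shows "lin_trace W f = (\<Sum>k\<in>K. \<xi> k (f (x k)))"
proof -
  define B where "B = (SOME B. B \<subseteq> W \<and> complex_vector.independent B \<and> complex_vector.span B = W)"
  have "\<exists>B. B \<subseteq> W \<and> complex_vector.independent B \<and> complex_vector.span B = W"
  proof -
    obtain B where "B \<subseteq> W" "complex_vector.independent B" "W \<subseteq> complex_vector.span B"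
      using complex_vector.maximal_independent_subset[of W] by blast
    then show ?thesis
      using complex_vector.span_minimal[of B W] W by blast
  qed
  then have "B \<subseteq> W \<and> complex_vector.independent B \<and> complex_vector.span B = W"
    unfolding B_def by (rule someI_ex)
  then have B: "B \<subseteq> W" "complex_vector.independent B" "complex_vector.span B = W" by auto
  \<comment> \<open>The basis picked inside \<open>lin_trace\<close> comes without a finiteness
    guarantee. The frame spans \<open>W\<close>, which bounds every independent set, so the sums
    over \<open>B\<close> are genuine.\<close>
  have "W \<subseteq> complex_vector.span (x ` K)"
  proof
    fix y assume "y \<in> W"
    have "(\<Sum>k\<in>K. \<xi> k y *\<^sub>C x k) \<in> complex_vector.span (x ` K)"
      by (intro complex_vector.span_sum complex_vector.span_scale) (simp add: complex_vector.span_base)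
    then show "y \<in> complex_vector.span (x ` K)"
      using frame[OF \<open>y \<in> W\<close>] by simp
  qed
  then have finB: "finite B"
    using complex_vector.independent_span_bound[of "x ` K" B] K B by auto
  let ?r = "\<lambda>y b. complex_vector.representation B y b"
  have rep: "?r (f b) b = (\<Sum>k\<in>K. \<xi> k b * ?r (f (x k)) b)" if b: "b \<in> B" for b
  proof -
    have bW: "b \<in> W" using b B(1) by auto
    have "f b = f (\<Sum>k\<in>K. \<xi> k b *\<^sub>C x k)" using frame[OF bW] by simp
    also have "\<dots> = (\<Sum>k\<in>K. \<xi> k b *\<^sub>C f (x k))"
      by (rule linear_on_sum[OF W f_add f_scale x])
    finally have "?r (f b) b = ?r (\<Sum>k\<in>K. \<xi> k b *\<^sub>C f (x k)) b" by simp
    also have "\<dots> = (\<Sum>k\<in>K. \<xi> k b *\<^sub>C ?r (f (x k)) b)"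
      by (rule linear_on_sum[OF W, where f = "\<lambda>y. ?r y b"])
        (use B f x in \<open>auto simp: complex_vector.representation_add complex_vector.representation_scale
           scaleC_complex_def\<close>)
    finally show ?thesis by (simp add: scaleC_complex_def)
  qed
  have "lin_trace W f = (\<Sum>b\<in>B. ?r (f b) b)"
    by (simp add: lin_trace_def B_def Let_def)
  also have "\<dots> = (\<Sum>b\<in>B. \<Sum>k\<in>K. \<xi> k b * ?r (f (x k)) b)"
    by (simp add: rep)
  also have "\<dots> = (\<Sum>k\<in>K. \<Sum>b\<in>B. ?r (f (x k)) b *\<^sub>C \<xi> k b)"
    by (subst sum.swap) (simp add: scaleC_complex_def mult.commute)
  \<comment> \<open>Linearity of \<open>\<xi> k\<close> reassembles \<open>f (x k)\<close> from its
    coordinates in \<open>B\<close>, which removes the chosen basis from the formula.\<close>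
  also have "\<dots> = (\<Sum>k\<in>K. \<xi> k (f (x k)))"
  proof (rule sum.cong[OF refl])
    fix k assume k: "k \<in> K"
    have "(\<Sum>b\<in>B. ?r (f (x k)) b *\<^sub>C \<xi> k b) = \<xi> k (\<Sum>b\<in>B. ?r (f (x k)) b *\<^sub>C b)"
      by (rule linear_on_sum[OF W, where f = "\<xi> k", symmetric])
        (use k B in \<open>auto simp: \<xi>_add \<xi>_scale scaleC_complex_def\<close>)
    also have "(\<Sum>b\<in>B. ?r (f (x k)) b *\<^sub>C b) = f (x k)"
      using B f x k finB by (intro complex_vector.sum_representation_eq) auto
    finally show "(\<Sum>b\<in>B. ?r (f (x k)) b *\<^sub>C \<xi> k b) = \<xi> k (f (x k))" .
  qed
  finally show ?thesis .
qed

section \<open>Finite bases, spaces of linear maps and bilinear forms\<close>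

lemma fin_dim_space_basis:
  assumes "fin_dim_space V"
  obtains B where "finite B" "complex_vector.independent B" "complex_vector.span B = V"
proof -
  obtain A where A: "finite A" "complex_vector.span A = V"
    using assms by (auto simp: fin_dim_space_def)
  obtain B where B: "B \<subseteq> A" "complex_vector.independent B" "A \<subseteq> complex_vector.span B"
    using complex_vector.maximal_independent_subset[of A] by blast
  have "complex_vector.span B = complex_vector.span A"
    using B complex_vector.span_mono complex_vector.span_minimal by (metis complex_vector.subspace_span subset_antisym)
  then show ?thesis
    using that[of B] A B finite_subset[OF B(1)] by auto
qed

lemma lin_mapsD:
  assumes "f \<in> lin_maps V W"
  shows "x \<in> V \<Longrightarrow> f x \<in> W"
    and "x \<in> V \<Longrightarrow> y \<in> V \<Longrightarrow> f (x + y) = f x + f y"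
    and "x \<in> V \<Longrightarrow> f (c *\<^sub>C x) = c *\<^sub>C f x"
    and "x \<notin> V \<Longrightarrow> f x = 0"
  using assms by (auto simp: lin_maps_def)

text \<open>A finite basis with its coordinate functionals is a frame, so the trace does not depend
  on the basis chosen in its definition.\<close>

lemma lin_trace_representation:
  assumes B: "finite B" "complex_vector.independent B" "complex_vector.span B = V"
    and f: "f \<in> lin_maps V V"
  shows "lin_trace V f = (\<Sum>b\<in>B. complex_vector.representation B (f b) b)"
proof (rule lin_trace_frame)
  show "y = (\<Sum>k\<in>B. complex_vector.representation B y k *\<^sub>C k)" if "y \<in> V" for y
    using complex_vector.sum_representation_eq[of B y B] B that by simp
  show "k \<in> V" if "k \<in> B" for k
    using that B(3) complex_vector.span_base by blast
  show "complex_vector.representation B (y + z) k =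
      complex_vector.representation B y k + complex_vector.representation B z k"
    if "y \<in> V" "z \<in> V" for k y z
    using that B by (simp add: complex_vector.representation_add)
  show "complex_vector.representation B (c *\<^sub>C y) k = c * complex_vector.representation B y k"
    if "y \<in> V" for k c y
    using that B by (simp add: complex_vector.representation_scale)
  show "complex_vector.subspace V"
    using B(3) complex_vector.subspace_span by blast
qed (use B(1) lin_mapsD[OF f] in auto)

lemma sum_fun_apply: "(\<Sum>k\<in>K. f k) x = (\<Sum>k\<in>K. f k x)"
  for f :: "'k \<Rightarrow> 'a \<Rightarrow> 'b::comm_monoid_add"
  by (induction K rule: infinite_finite_induct) auto

lemma lin_maps_0:
  assumes "f \<in> lin_maps V W" and "complex_vector.subspace V"
  shows "f 0 = 0"
  using lin_mapsD(3)[OF assms(1) complex_vector.subspace_0[OF assms(2)], of 0] by simp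

lemma lin_maps_comp:
  assumes "f \<in> lin_maps U V" and "g \<in> lin_maps V W" and "complex_vector.subspace V"
  shows "g \<circ> f \<in> lin_maps U W"
  using assms lin_maps_0[OF assms(2,3)] by (auto simp: lin_maps_def)

lemma scaleC_fun_apply: "(c *\<^sub>C f) x = c *\<^sub>C f x"
  by (simp add: scaleC_fun_def)

lemma subspace_dual: "complex_vector.subspace (dual V)"
  by (auto simp: complex_vector.subspace_def dual_def lin_maps_def scaleC_fun_apply scaleC_complex_def
      distrib_left)

text \<open>Currying for maps extended by zero. The argument that is held fixed ranges over the
  whole type, since both sides vanish when it lies outside \<open>V\<close>.\<close>

lemma bilin_maps_iff:
  assumes V: "complex_vector.subspace V"
  shows "C \<in> lin_maps V (dual V) \<longleftrightarrow>
     (\<forall>x\<in>V. \<forall>y\<in>V. \<forall>w. C (x + y) w = C x w + C y w) \<and>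
     (\<forall>c. \<forall>x\<in>V. \<forall>w. C (c *\<^sub>C x) w = c * C x w) \<and>
     (\<forall>v. \<forall>x\<in>V. \<forall>y\<in>V. C v (x + y) = C v x + C v y) \<and>
     (\<forall>v. \<forall>c. \<forall>x\<in>V. C v (c *\<^sub>C x) = c * C v x) \<and>
     (\<forall>v w. v \<notin> V \<or> w \<notin> V \<longrightarrow> C v w = 0)"
proof -
  have "C v (x + y) = C v x + C v y" "C v (c *\<^sub>C x) = c * C v x"
    if "\<forall>x\<in>V. C x \<in> lin_maps V UNIV" "\<forall>x. x \<notin> V \<longrightarrow> C x = (\<lambda>_. 0)" "x \<in> V" "y \<in> V" for v x y c
    using that by (cases "v \<in> V"; simp add: lin_maps_def scaleC_complex_def)+
  then show ?thesis
    by (auto simp: lin_maps_def dual_def scaleC_fun_def scaleC_complex_def fun_eq_iff zero_fun_def)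
qed


section \<open>Scalar identities for a twisted cocycle\<close>

locale twisted_extension = group Gh for Gh :: "('g, 'm) monoid_scheme" (structure) +
  fixes \<pi> :: "'g \<Rightarrow> int" and \<theta> :: "'g \<Rightarrow> 'g \<Rightarrow> complex" and \<chi> :: "'g \<Rightarrow> complex" and s :: 'g
  assumes finite_carrier: "finite (carrier Gh)"
    and \<pi>_hom: "\<pi> \<in> hom Gh C2"
    and cocycle: "twisted_cocycle Gh \<pi> \<theta>"
    and \<chi>_hom: "\<chi> \<in> hom Gh U1"
    and s: "s \<in> carrier Gh" "\<pi> s = -1"
begin

abbreviation K where "K \<equiv> kernel Gh C2 \<pi>"

section \<open>Parity, the kernel, and the cocycle identity for even and odd elements\<close>

lemma \<pi>_mult: "x \<in> carrier Gh \<Longrightarrow> y \<in> carrier Gh \<Longrightarrow> \<pi> (x \<otimes> y) = \<pi> x * \<pi> y"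
  using \<pi>_hom by (auto simp: hom_def C2_def)

lemma \<pi>_cases: "x \<in> carrier Gh \<Longrightarrow> \<pi> x = 1 \<or> \<pi> x = -1"
  using \<pi>_hom by (auto simp: hom_def C2_def)

lemma \<pi>_one: "\<pi> \<one> = 1"
  using \<pi>_mult[of \<one> \<one>] \<pi>_cases[of \<one>] by auto

lemma \<pi>_inv: "x \<in> carrier Gh \<Longrightarrow> \<pi> (inv x) = \<pi> x"
  using \<pi>_mult[of x "inv x"] \<pi>_cases[of x] \<pi>_cases[of "inv x"] \<pi>_one by auto

lemma K_iff: "x \<in> K \<longleftrightarrow> x \<in> carrier Gh \<and> \<pi> x = 1"
  by (auto simp: kernel_def C2_def)

lemma K_closed:
  assumes "x \<in> K" shows "x \<in> carrier Gh" "inv x \<in> K" "y \<in> K \<Longrightarrow> x \<otimes> y \<in> K" "\<one> \<in> K"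
  using assms by (auto simp: K_iff \<pi>_mult \<pi>_inv \<pi>_one)

lemma subgroup_K: "subgroup K Gh"
  by (rule subgroup.intro) (auto simp: K_iff \<pi>_mult \<pi>_inv \<pi>_one)

lemma inv_K: "x \<in> K \<Longrightarrow> inv\<^bsub>Gh\<lparr>carrier := K\<rparr>\<^esub> x = inv x"
  by (rule m_inv_consistent[OF subgroup_K])

lemma \<theta>_nonzero: "x \<in> carrier Gh \<Longrightarrow> y \<in> carrier Gh \<Longrightarrow> \<theta> x y \<noteq> 0"
  using cocycle by (fastforce simp: twisted_cocycle_def U1_def)

lemma \<theta>_one:
  assumes "x \<in> carrier Gh" shows "\<theta> x \<one> = 1" "\<theta> \<one> x = 1"
  using cocycle assms by (auto simp: twisted_cocycle_def)

lemma cocycle_even: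
  assumes "c \<in> K" "b \<in> carrier Gh" "a \<in> carrier Gh"
  shows "\<theta> b a * \<theta> c (b \<otimes> a) = \<theta> (c \<otimes> b) a * \<theta> c b"
proof -
  have "\<theta> b a powi \<pi> c * \<theta> c (b \<otimes> a) = \<theta> (c \<otimes> b) a * \<theta> c b"
    using cocycle assms unfolding twisted_cocycle_def K_iff by blast
  then show ?thesis using assms by (simp add: K_iff)
qed

text \<open>The exponent \<open>\<pi> c\<close> is \<open>-1\<close>; the inverted factor
  \<open>\<theta> b a\<close> is nonzero and is moved to the other side.\<close>

lemma cocycle_odd:
  assumes "c \<in> carrier Gh" "\<pi> c = -1" "b \<in> carrier Gh" "a \<in> carrier Gh"
  shows "\<theta> c (b \<otimes> a) = \<theta> b a * \<theta> (c \<otimes> b) a * \<theta> c b"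
proof -
  have "\<theta> b a powi \<pi> c * \<theta> c (b \<otimes> a) = \<theta> (c \<otimes> b) a * \<theta> c b"
    using cocycle assms unfolding twisted_cocycle_def by blast
  then show ?thesis using assms \<theta>_nonzero[of b a] by (simp add: power_int_minus field_simps)
qed

text \<open>The cocycle identity for the triple \<open>x\<close>, \<open>inv x\<close>,
  \<open>x\<close>, where normalisation removes the two other factors.\<close>

lemma \<theta>_inv_commute:
  assumes x: "x \<in> K" shows "\<theta> (inv x) x = \<theta> x (inv x)"
  using cocycle_even[of x "inv x" x] x by (simp add: K_iff \<theta>_one)

text \<open>Two odd cocycle identities, for the triples \<open>u, inv u, inv u\<close> and
  \<open>u, u, inv u \<otimes> inv u\<close>. The result trades
  \<open>1 / \<theta> (inv u) (inv u)\<close> for \<open>\<theta> u u\<close>, both in the formula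
  for \<open>\<iota>\<close> and in the final inversion of the summation variable.\<close>

lemma \<theta>_square_inv:
  assumes u: "u \<in> carrier Gh" "\<pi> u = -1"
  shows "\<theta> u u * \<theta> (inv u) (inv u) * \<theta> (u \<otimes> u) (inv u \<otimes> inv u) = 1"
proof -
  let ?t = "inv u"
  have t: "?t \<in> carrier Gh" using u by simp
  have nz: "\<theta> u ?t \<noteq> 0" using \<theta>_nonzero u t by auto
  have 1: "\<theta> u (?t \<otimes> ?t) = \<theta> ?t ?t * \<theta> u ?t"
    using cocycle_odd[of u ?t ?t] u t by (simp add: \<theta>_one)
  have "\<theta> u (u \<otimes> (?t \<otimes> ?t)) = \<theta> u (?t \<otimes> ?t) * \<theta> (u \<otimes> u) (?t \<otimes> ?t) * \<theta> u u"
    using cocycle_odd[of u u "?t \<otimes> ?t"] u t by simp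
  moreover have "u \<otimes> (?t \<otimes> ?t) = ?t" using u t by (simp add: m_assoc[symmetric])
  ultimately have "\<theta> u ?t = (\<theta> ?t ?t * \<theta> u ?t) * \<theta> (u \<otimes> u) (?t \<otimes> ?t) * \<theta> u u"
    by (simp add: 1)
  then have "\<theta> u ?t * (\<theta> u u * \<theta> ?t ?t * \<theta> (u \<otimes> u) (?t \<otimes> ?t)) = \<theta> u ?t * 1" by (simp add: mult_ac)
  then show ?thesis using nz by (metis mult_left_cancel)
qed

section \<open>The character, conjugation by \<open>s\<close>, and the weights\<close>

lemma \<chi>_mult: "x \<in> carrier Gh \<Longrightarrow> y \<in> carrier Gh \<Longrightarrow> \<chi> (x \<otimes> y) = \<chi> x * \<chi> y"
  using \<chi>_hom by (auto simp: hom_def U1_def)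

lemma \<chi>_nonzero: "x \<in> carrier Gh \<Longrightarrow> \<chi> x \<noteq> 0"
  using hom_in_carrier[OF \<chi>_hom, of x] by (auto simp: U1_def)

lemma \<chi>_one: "\<chi> \<one> = 1"
  using \<chi>_mult[of \<one> \<one>] \<chi>_nonzero[of \<one>] by simp

lemma \<chi>_inv: "x \<in> carrier Gh \<Longrightarrow> \<chi> (inv x) = 1 / \<chi> x"
  using \<chi>_mult[of "inv x" x] \<chi>_nonzero[of x] by (simp add: \<chi>_one field_simps)

definition cj :: "'g \<Rightarrow> 'g" where "cj x = s \<otimes> x \<otimes> inv s"

lemma cj_closed: "x \<in> carrier Gh \<Longrightarrow> cj x \<in> carrier Gh"
  using s by (simp add: cj_def)

lemma cj_K: "x \<in> K \<Longrightarrow> cj x \<in> K"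
  using s by (auto simp: K_iff cj_def \<pi>_mult \<pi>_inv)

lemma cj_s: "x \<in> carrier Gh \<Longrightarrow> cj x \<otimes> s = s \<otimes> x"
  using s by (simp add: cj_def m_assoc)

lemma cj_mult: "x \<in> carrier Gh \<Longrightarrow> y \<in> carrier Gh \<Longrightarrow> cj (x \<otimes> y) = cj x \<otimes> cj y"
proof -
  assume xy: "x \<in> carrier Gh" "y \<in> carrier Gh"
  have "cj (x \<otimes> y) \<otimes> s = cj x \<otimes> cj y \<otimes> s"
    using xy s by (simp add: cj_s m_assoc cj_closed) (simp add: cj_s cj_closed flip: m_assoc)
  then show ?thesis using xy s by (simp add: cj_closed)
qed

lemma cj_inv: "x \<in> carrier Gh \<Longrightarrow> cj (inv x) = inv (cj x)"
  using s by (simp add: cj_def inv_mult_group m_assoc)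

text \<open>The scalars that turn \<open>C \<mapsto> C (\<rho> g v) (\<rho> (cj g) w)\<close>, only a twisted action on bilinear forms, into
  an honest one with the \<open>G\<close>-equivariant maps \<open>V \<rightarrow> P(V)\<close> as its fixed points.\<close>

definition wt :: "'g \<Rightarrow> complex" where "wt x = \<theta> s x / (\<chi> x * \<theta> (cj x) s)"

lemma wt_nonzero: "x \<in> carrier Gh \<Longrightarrow> wt x \<noteq> 0"
  using s by (simp add: wt_def \<theta>_nonzero \<chi>_nonzero cj_closed)

text \<open>Up to the coboundary of \<open>wt\<close>, conjugation by the odd element
  \<open>s\<close> inverts \<open>\<theta>\<close> on \<open>K\<close>. This follows from the
  cocycle identities for the triples \<open>cj x, cj y, s\<close> and \<open>cj x, s, y\<close> and
  \<open>s, x, y\<close>, of which only the last has an odd first entry. Hence the weighted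
  operators on forms compose without a multiplier.\<close>

lemma wt_mult:
  assumes x: "x \<in> K" and y: "y \<in> K"
  shows "wt x * wt y * \<theta> x y * \<theta> (cj x) (cj y) = wt (x \<otimes> y)"
proof -
  note c = K_closed(1)[OF x] K_closed(1)[OF y]
  note nz = \<theta>_nonzero \<chi>_nonzero cj_closed c s
  have 1: "\<theta> (cj y) s * \<theta> (cj x) (s \<otimes> y) = \<theta> (cj x \<otimes> cj y) s * \<theta> (cj x) (cj y)"
    using cocycle_even[of "cj x" "cj y" s] cj_K[OF x] c s by (simp add: cj_closed cj_s)
  have 2: "\<theta> (s \<otimes> x) y * \<theta> (cj x) s = \<theta> s y * \<theta> (cj x) (s \<otimes> y)"
    using cocycle_even[of "cj x" s y] cj_K[OF x] c s by (simp add: cj_s)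
  have 3: "\<theta> s (x \<otimes> y) = \<theta> x y * \<theta> (s \<otimes> x) y * \<theta> s x"
    using cocycle_odd[of s x y] c s by simp
  have "\<theta> s (x \<otimes> y) * \<theta> (cj x) s * \<theta> (cj y) s =
      \<theta> x y * \<theta> s x * \<theta> (cj y) s * (\<theta> (s \<otimes> x) y * \<theta> (cj x) s)"
    unfolding 3 by (simp only: mult_ac)
  also have "\<dots> = \<theta> x y * \<theta> s x * \<theta> s y * (\<theta> (cj y) s * \<theta> (cj x) (s \<otimes> y))"
    unfolding 2 by (simp only: mult_ac)
  finally have e: "\<theta> s (x \<otimes> y) * \<theta> (cj x) s * \<theta> (cj y) s =
      \<theta> x y * \<theta> s x * \<theta> s y * (\<theta> (cj x \<otimes> cj y) s * \<theta> (cj x) (cj y))"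
    unfolding 1 .
  show ?thesis
    unfolding wt_def cj_mult[OF c] \<chi>_mult[OF c]
    using e by (simp add: nz divide_simps mult_ac)
qed

text \<open>Since \<open>\<rho> (inv (cj x))\<close> is \<open>\<theta> (inv (cj x)) (cj x)\<close>
  times the inverse of \<open>\<rho> (cj x)\<close>, this says that the dual representation acts by
  \<open>1 / wt x\<close> times the dual of that inverse.\<close>

lemma loop_trans_eq:
  assumes x: "x \<in> K"
  shows "\<chi> x / loop_trans Gh \<pi> \<theta> s x = 1 / (wt x * \<theta> (inv (cj x)) (cj x))"
proof -
  note c = K_closed(1)[OF x]
  note nz = \<theta>_nonzero \<chi>_nonzero cj_closed c s
  let ?h = "cj x"
  have h: "?h \<in> K" "?h \<in> carrier Gh" "inv ?h \<in> K" "inv ?h \<in> carrier Gh"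
    using x by (auto simp: cj_K cj_closed c K_closed)
  have pw: "x [^] (-1 :: int) = inv x" using c int_pow_neg[OF c, of 1] by simp
  have cji: "s \<otimes> inv x \<otimes> inv s = inv ?h" using cj_inv[OF c] by (simp add: cj_def)
  \<comment> \<open>As \<open>s\<close> is odd, the exponent \<open>(\<pi> s - 1) div 2\<close> is
    exactly \<open>-1\<close> and the power of \<open>x\<close> is \<open>inv x\<close>.\<close>
  have T: "loop_trans Gh \<pi> \<theta> s x = \<theta> (inv ?h) s / (\<theta> (inv x) x * \<theta> s (inv x))"
    unfolding loop_trans_def using s nz by (simp add: pw cji power_int_minus divide_simps)
  have 1: "\<theta> (inv ?h) ?h = \<theta> ?h s * \<theta> (inv ?h) (s \<otimes> x)"
    using cocycle_even[of "inv ?h" ?h s] h s c by (simp add: \<theta>_one cj_s)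
  have 2: "\<theta> s x * \<theta> (inv ?h) (s \<otimes> x) = \<theta> (s \<otimes> inv x) x * \<theta> (inv ?h) s"
    using cocycle_even[of "inv ?h" s x] h s c cj_s[of "inv x"] by (simp add: cj_inv)
  have 3: "1 = \<theta> (inv x) x * \<theta> (s \<otimes> inv x) x * \<theta> s (inv x)"
    using cocycle_odd[of s "inv x" x] s c by (simp add: \<theta>_one)
  have "\<theta> (inv ?h) s * \<theta> ?h s =
      \<theta> (inv ?h) s * \<theta> ?h s * (\<theta> (inv x) x * \<theta> (s \<otimes> inv x) x * \<theta> s (inv x))"
    using 3 by simp
  also have "\<dots> = (\<theta> (s \<otimes> inv x) x * \<theta> (inv ?h) s) * \<theta> ?h s * (\<theta> (inv x) x * \<theta> s (inv x))"
    by (simp only: mult_ac)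
  also have "\<dots> = \<theta> s x * \<theta> (inv ?h) ?h * (\<theta> (inv x) x * \<theta> s (inv x))"
    unfolding 1 2[symmetric] by (simp only: mult_ac)
  finally have "\<theta> (inv ?h) s * \<theta> ?h s = \<theta> s x * \<theta> (inv ?h) ?h * (\<theta> (inv x) x * \<theta> s (inv x))" .
  then have T': "loop_trans Gh \<pi> \<theta> s x = \<theta> s x * \<theta> (inv ?h) ?h / \<theta> ?h s"
    unfolding T using nz by (simp add: divide_simps mult_ac)
  show ?thesis unfolding T' wt_def using nz by (simp add: divide_simps)
qed

text \<open>The elements \<open>cj (cj x) \<otimes> (s \<otimes> s)\<close> and
  \<open>(s \<otimes> s) \<otimes> x\<close> agree, and this compares the multipliers of the two
  products. It is the scalar condition under which \<open>\<iota>\<close> preserves equivariance.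
  The character drops out because it is invariant under conjugation.\<close>

lemma wt_cj:
  assumes x: "x \<in> K"
  shows "wt x * \<theta> (s \<otimes> s) x = wt (cj x) * \<theta> (cj (cj x)) (s \<otimes> s)"
proof -
  note c = K_closed(1)[OF x]
  let ?h = "cj x" and ?m = "cj (cj x)"
  have h: "?h \<in> carrier Gh" "?m \<in> carrier Gh" "?m \<in> K"
    using x by (auto simp: cj_K cj_closed c)
  note nz = \<theta>_nonzero \<chi>_nonzero h c s
  have ch: "\<chi> ?h = \<chi> x" using c s by (simp add: cj_def \<chi>_mult \<chi>_inv \<chi>_nonzero)
  have 1: "\<theta> s (s \<otimes> x) = \<theta> s x * \<theta> (s \<otimes> s) x * \<theta> s s"
    using cocycle_odd[of s s x] s c by simp
  have 2: "\<theta> s s * \<theta> ?m (s \<otimes> s) = \<theta> (s \<otimes> ?h) s * \<theta> ?m s"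
    using cocycle_even[of ?m s s] s h by (simp add: cj_s)
  have 3: "\<theta> s (s \<otimes> x) = \<theta> ?h s * \<theta> (s \<otimes> ?h) s * \<theta> s ?h"
    using cocycle_odd[of s ?h s] s h by (simp add: cj_s c)
  have "\<theta> s s * (\<theta> s x * \<theta> (s \<otimes> s) x * \<theta> ?m s) = \<theta> s s * (\<theta> s ?h * \<theta> ?m (s \<otimes> s) * \<theta> ?h s)"
  proof -
    have "\<theta> s s * (\<theta> s x * \<theta> (s \<otimes> s) x * \<theta> ?m s) = \<theta> s (s \<otimes> x) * \<theta> ?m s"
      unfolding 1 by (simp only: mult_ac)
    also have "\<dots> = (\<theta> (s \<otimes> ?h) s * \<theta> ?m s) * \<theta> s ?h * \<theta> ?h s"
      unfolding 3 by (simp only: mult_ac)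
    finally show ?thesis
      unfolding 2[symmetric] by (simp only: mult_ac)
  qed
  then have e: "\<theta> s x * \<theta> (s \<otimes> s) x * \<theta> ?m s = \<theta> s ?h * \<theta> ?m (s \<otimes> s) * \<theta> ?h s"
    using nz by simp
  show ?thesis unfolding wt_def ch using nz e by (simp add: divide_simps mult_ac)
qed

text \<open>The factors on the right are those of the operators that meet in the trace:
  \<open>\<rho> g\<close>, \<open>\<rho> (cj g)\<close> and
  \<open>\<rho> (s \<otimes> s)\<close>.\<close>

lemma square_mult_s:
  assumes x: "x \<in> carrier Gh"
  shows "(x \<otimes> s) \<otimes> (x \<otimes> s) = (x \<otimes> cj x) \<otimes> (s \<otimes> s)"
proof -
  have "x \<otimes> cj x \<otimes> (s \<otimes> s) = x \<otimes> (cj x \<otimes> s) \<otimes> s"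
    using x s by (simp add: m_assoc cj_closed)
  then show ?thesis using x s by (simp add: cj_s) (simp add: m_assoc)
qed

text \<open>The right side collects the scalars of the trace computation:
  \<open>\<theta> s s\<close> from \<open>\<iota>\<close>, \<open>wt x\<close> from averaging, and
  two multipliers from merging three operators into one. The factor \<open>\<chi> x\<close> cancels
  the character inside \<open>wt x\<close>.\<close>

lemma \<theta>_square_mult_s:
  assumes x: "x \<in> K"
  shows "\<theta> (x \<otimes> s) (x \<otimes> s) = \<theta> s s * (\<chi> x * wt x * \<theta> x (cj x) * \<theta> (x \<otimes> cj x) (s \<otimes> s))"
proof -
  note c = K_closed(1)[OF x]
  let ?h = "cj x"
  have h: "?h \<in> carrier Gh" "?h \<in> K"
    using x by (auto simp: cj_K cj_closed c)
  note nz = \<theta>_nonzero \<chi>_nonzero h c s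
  have hs: "?h \<otimes> (s \<otimes> s) = s \<otimes> (x \<otimes> s)" using h c s by (simp add: cj_s flip: m_assoc)
  have 1: "\<theta> s (x \<otimes> s) * \<theta> x (s \<otimes> (x \<otimes> s)) = \<theta> (x \<otimes> s) (x \<otimes> s) * \<theta> x s"
    using cocycle_even[of x s "x \<otimes> s"] x c s by simp
  have 2: "\<theta> s (x \<otimes> s) = \<theta> x s * \<theta> (s \<otimes> x) s * \<theta> s x"
    using cocycle_odd[of s x s] c s by simp
  have 3: "\<theta> s s * \<theta> ?h (s \<otimes> s) = \<theta> (s \<otimes> x) s * \<theta> ?h s"
    using cocycle_even[of ?h s s] h s c by (simp add: cj_s)
  have 4: "\<theta> ?h (s \<otimes> s) * \<theta> x (s \<otimes> (x \<otimes> s)) = \<theta> (x \<otimes> ?h) (s \<otimes> s) * \<theta> x ?h"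
    using cocycle_even[of x ?h "s \<otimes> s"] h s c x by (simp add: hs)
  have "\<theta> x s * (\<theta> (x \<otimes> s) (x \<otimes> s) * \<theta> ?h s) =
    \<theta> x s * (\<theta> s s * \<theta> s x * \<theta> (x \<otimes> ?h) (s \<otimes> s) * \<theta> x ?h)"
  proof -
    have "\<theta> x s * (\<theta> (x \<otimes> s) (x \<otimes> s) * \<theta> ?h s) = (\<theta> (x \<otimes> s) (x \<otimes> s) * \<theta> x s) * \<theta> ?h s"
      by (simp only: mult_ac)
    also have "\<dots> = \<theta> x s * \<theta> s x * (\<theta> (s \<otimes> x) s * \<theta> ?h s) * \<theta> x (s \<otimes> (x \<otimes> s))"
      unfolding 1[symmetric] 2 by (simp only: mult_ac)
    also have "\<dots> = \<theta> x s * \<theta> s s * \<theta> s x * (\<theta> ?h (s \<otimes> s) * \<theta> x (s \<otimes> (x \<otimes> s)))"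
      unfolding 3[symmetric] by (simp only: mult_ac)
    finally show ?thesis
      unfolding 4 by (simp only: mult_ac)
  qed
  then have "\<theta> (x \<otimes> s) (x \<otimes> s) * \<theta> ?h s = \<theta> s s * \<theta> s x * \<theta> (x \<otimes> ?h) (s \<otimes> s) * \<theta> x ?h"
    using nz by simp
  then show ?thesis unfolding wt_def using nz by (simp add: divide_simps mult_ac)
qed

end


section \<open>Equivariant forms and the trace\<close>

locale twisted_extension_rep = twisted_extension Gh \<pi> \<theta> \<chi> s
  for Gh :: "('g, 'm) monoid_scheme" (structure) and \<pi> \<theta> \<chi> s +
  fixes V :: "'v::complex_vector set" and \<rho> :: "'g \<Rightarrow> 'v \<Rightarrow> 'v" and \<phi> :: "'v \<Rightarrow> 'v"
  assumes rep: "twisted_rep (ker_group Gh \<pi>) \<theta> (V, \<rho>)"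
    and \<phi>_hom: "\<phi> \<in> rep_hom (ker_group Gh \<pi>) (V, \<rho>) (V, \<rho>)"
begin

section \<open>The representation, and equivariance as invariance of forms\<close>

lemma V_fin_dim: "fin_dim_space V"
  using rep by simp

lemma V_subspace: "complex_vector.subspace V"
  using V_fin_dim by (simp add: fin_dim_space_def)

lemma \<rho>_lin: "g \<in> K \<Longrightarrow> \<rho> g \<in> lin_maps V V"
  using rep by (simp add: ker_group_def general_linear_def)

lemma \<rho>_bij: "g \<in> K \<Longrightarrow> bij_betw (\<rho> g) V V"
  using rep by (simp add: ker_group_def general_linear_def)

lemma \<rho>_mult: "h \<in> K \<Longrightarrow> g \<in> K \<Longrightarrow> \<rho> h (\<rho> g v) = \<theta> h g *\<^sub>C \<rho> (h \<otimes> g) v"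
  using rep by (auto simp: ker_group_def scaleC_fun_def fun_eq_iff)

lemma \<rho>_one: "v \<in> V \<Longrightarrow> \<rho> \<one> v = v"
  using rep by (simp add: ker_group_def lin_id_def ext0_def)

text \<open>This holds for every \<open>v\<close>: outside \<open>V\<close> the value is 0, which
  again lies in \<open>V\<close>.\<close>

lemma \<rho>_closed: "g \<in> K \<Longrightarrow> \<rho> g v \<in> V"
  using lin_mapsD(1,4)[OF \<rho>_lin, of g v] complex_vector.subspace_0[OF V_subspace] by (cases "v \<in> V") auto

lemma \<phi>_lin: "\<phi> \<in> lin_maps V V"
  using \<phi>_hom by simp

lemma \<phi>_closed: "\<phi> v \<in> V"
  using lin_mapsD(1,4)[OF \<phi>_lin, of v] complex_vector.subspace_0[OF V_subspace] by (cases "v \<in> V") auto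

lemma \<phi>_commute: "g \<in> K \<Longrightarrow> \<phi> (\<rho> g v) = \<rho> g (\<phi> v)"
  using \<phi>_hom by (auto simp: ker_group_def fun_eq_iff)

abbreviation bil where "bil \<equiv> lin_maps V (dual V)"

abbreviation H where
  "H \<equiv> rep_hom (ker_group Gh \<pi>) (V, \<rho>) (dual_rep Gh \<pi> \<theta> \<chi> s (V, \<rho>))"

lemma bilD:
  assumes "C \<in> bil"
  shows "x \<in> V \<Longrightarrow> y \<in> V \<Longrightarrow> C (x + y) w = C x w + C y w"
    and "x \<in> V \<Longrightarrow> C (c *\<^sub>C x) w = c * C x w"
    and "x \<in> V \<Longrightarrow> y \<in> V \<Longrightarrow> C v (x + y) = C v x + C v y"
    and "x \<in> V \<Longrightarrow> C v (c *\<^sub>C x) = c * C v x"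
    and "v \<notin> V \<Longrightarrow> C v w = 0" and "w \<notin> V \<Longrightarrow> C v w = 0"
  using assms bilin_maps_iff[OF V_subspace] by blast+

lemma bil_dual: "C \<in> bil \<Longrightarrow> C v \<in> dual V"
  using lin_mapsD(1,4)[of C V "dual V" v] by (cases "v \<in> V") (auto simp: dual_def lin_maps_def scaleC_complex_def)

text \<open>By \<open>loop_trans_eq\<close> the action on the dual is, up to
  \<open>1 / wt g\<close>, precomposition with the inverse of \<open>\<rho> (cj g)\<close>; moving
  this operator across the equation gives the invariance.\<close>

lemma H_iff:
  "C \<in> H \<longleftrightarrow>
     C \<in> bil \<and> (\<forall>g\<in>K. \<forall>v\<in>V. \<forall>w\<in>V. wt g * C (\<rho> g v) (\<rho> (cj g) w) = C v w)"
proof (cases "C \<in> bil")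
  case True
  have eq: "C \<circ> \<rho> g = ((\<chi> g / loop_trans Gh \<pi> \<theta> s g) *\<^sub>C
       dual_map V (\<rho> (s \<otimes> inv g \<otimes> inv s))) \<circ> C \<longleftrightarrow>
     (\<forall>v\<in>V. \<forall>w\<in>V. wt g * C (\<rho> g v) (\<rho> (cj g) w) = C v w)"
    (is "?L \<longleftrightarrow> ?R") if g: "g \<in> K" for g
  proof -
    let ?h = "cj g"
    let ?c = "wt g * \<theta> (inv ?h) ?h"
    have h: "?h \<in> K" "inv ?h \<in> K" "?h \<in> carrier Gh" "inv ?h \<in> carrier Gh" "g \<in> carrier Gh"
      using g by (auto simp: K_closed cj_K)
    have nz: "?c \<noteq> 0" using h by (simp add: wt_nonzero \<theta>_nonzero)
    have cji: "s \<otimes> inv g \<otimes> inv s = inv ?h" using cj_inv[of g] h by (simp add: cj_def)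
    have "?L \<longleftrightarrow> (\<forall>v w. C (\<rho> g v) w = 1 / ?c * C v (\<rho> (inv ?h) w))"
      unfolding cji loop_trans_eq[OF g]
      by (simp add: fun_eq_iff scaleC_fun_def scaleC_complex_def dual_map_def ext0_def bil_dual[OF True])
    \<comment> \<open>Equality of functions on the whole type reduces to \<open>V\<close>, because
      both sides vanish as soon as one argument lies outside.\<close>
    also have "\<dots> \<longleftrightarrow> (\<forall>v\<in>V. \<forall>w\<in>V. C v (\<rho> (inv ?h) w) = ?c * C (\<rho> g v) w)" (is "_ \<longleftrightarrow> ?M")
    proof
      assume M: ?M
      show "\<forall>v w. C (\<rho> g v) w = 1 / ?c * C v (\<rho> (inv ?h) w)"
      proof (intro allI)
        fix v w
        show "C (\<rho> g v) w = 1 / ?c * C v (\<rho> (inv ?h) w)"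
        proof (cases "v \<in> V \<and> w \<in> V")
          case True
          then show ?thesis using M nz by simp
        next
          case False
          have "C 0 w = 0" "C v 0 = 0"
            using bilD(2)[OF True, of 0 0] bilD(4)[OF True, of 0 _ 0] complex_vector.subspace_0[OF V_subspace]
            by auto
          then show ?thesis
            using False lin_mapsD(4)[OF \<rho>_lin[OF g]] lin_mapsD(4)[OF \<rho>_lin[OF h(2)]] bilD(5,6)[OF True]
            by auto
        qed
      qed
    qed (use nz in auto)
    \<comment> \<open>Replace \<open>w\<close> by \<open>\<rho> ?h w\<close>, and conversely by
      \<open>\<rho> (inv ?h) w\<close>. On \<open>V\<close> these operators are mutually inverse up
      to the factor \<open>\<theta> (inv ?h) ?h\<close> contained in \<open>?c\<close>.\<close>
    also have "\<dots> \<longleftrightarrow> ?R"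
    proof
      assume M: ?M
      show ?R
      proof (intro ballI)
        fix v w assume v: "v \<in> V" and w: "w \<in> V"
        have "?c * C (\<rho> g v) (\<rho> ?h w) = C v (\<rho> (inv ?h) (\<rho> ?h w))"
          using M v \<rho>_closed[OF h(1)] by simp
        also have "\<dots> = \<theta> (inv ?h) ?h * C v w"
          using h w by (simp add: \<rho>_mult \<rho>_one bilD(4)[OF True])
        finally show "wt g * C (\<rho> g v) (\<rho> ?h w) = C v w"
          using nz by simp
      qed
    next
      assume R: ?R
      show ?M
      proof (intro ballI)
        fix v w assume v: "v \<in> V" and w: "w \<in> V"
        have "C v (\<rho> (inv ?h) w) = wt g * C (\<rho> g v) (\<rho> ?h (\<rho> (inv ?h) w))"
          using R v \<rho>_closed[OF h(2)] by simp
        also have "\<dots> = ?c * C (\<rho> g v) w"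
          using h w by (simp add: \<rho>_mult \<rho>_one bilD(4)[OF True] \<theta>_inv_commute)
        finally show "C v (\<rho> (inv ?h) w) = ?c * C (\<rho> g v) w" .
      qed
    qed
    finally show ?thesis .
  qed
  show ?thesis using True eq by (simp add: ker_group_def)
qed (simp)

lemma H_bil: "C \<in> H \<Longrightarrow> C \<in> bil"
  by simp

lemma H_invariant:
  "C \<in> H \<Longrightarrow> g \<in> K \<Longrightarrow> v \<in> V \<Longrightarrow> w \<in> V \<Longrightarrow> wt g * C (\<rho> g v) (\<rho> (cj g) w) = C v w"
  unfolding H_iff by blast

lemma H_subspace: "complex_vector.subspace H"
  unfolding complex_vector.subspace_def
proof (intro conjI ballI allI)
  show "0 \<in> H" unfolding H_iff by (simp add: bilin_maps_iff[OF V_subspace])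
next
  fix C D assume "C \<in> H" "D \<in> H"
  then show "C + D \<in> H"
    unfolding H_iff bilin_maps_iff[OF V_subspace] by (auto simp: algebra_simps)
next
  fix c C assume "C \<in> H"
  then show "c *\<^sub>C C \<in> H"
    unfolding H_iff bilin_maps_iff[OF V_subspace]
    by (simp add: algebra_simps scaleC_fun_def scaleC_complex_def)
qed

section \<open>The map \<open>\<iota>\<close> on invariant forms\<close>

abbreviation \<iota> where "\<iota> \<equiv> iota Gh \<theta> \<chi> s (V, \<rho>) \<phi>"

lemma ss_K: "s \<otimes> s \<in> K" "inv s \<otimes> inv s \<in> K"
  using s by (auto simp: K_iff \<pi>_mult \<pi>_inv)

text \<open>Dualising a form swaps its two arguments. The inverse of
  \<open>\<rho> (inv s \<otimes> inv s)\<close> is a multiple of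
  \<open>\<rho> (s \<otimes> s)\<close>, and \<open>\<theta>_square_inv\<close> evaluates the
  resulting scalar.\<close>

lemma iota_eq:
  assumes C: "C \<in> bil"
  shows "\<iota> C v w = \<chi> (inv s) * \<theta> s s * C w (\<rho> (s \<otimes> s) (\<phi> v))"
proof -
  let ?t = "inv s" and ?x = "\<phi> v"
  define y where "y = inv_into V (\<rho> (?t \<otimes> ?t)) ?x"
  have x: "?x \<in> V" by (rule \<phi>_closed)
  have "?x \<in> \<rho> (?t \<otimes> ?t) ` V"
    using \<rho>_bij[OF ss_K(2)] x by (simp add: bij_betw_def)
  then have y: "y \<in> V" "\<rho> (?t \<otimes> ?t) y = ?x"
    by (auto simp: y_def inv_into_into f_inv_into_f)
  have "\<rho> (s \<otimes> s) ?x = \<theta> (s \<otimes> s) (?t \<otimes> ?t) *\<^sub>C \<rho> ((s \<otimes> s) \<otimes> (?t \<otimes> ?t)) y"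
    using \<rho>_mult[OF ss_K, of y] y by simp
  moreover have "(s \<otimes> s) \<otimes> (?t \<otimes> ?t) = \<one>"
    using s by (metis inv_mult_group r_inv m_closed)
  ultimately have sx: "\<rho> (s \<otimes> s) ?x = \<theta> (s \<otimes> s) (?t \<otimes> ?t) *\<^sub>C y"
    using y by (simp add: \<rho>_one)
  \<comment> \<open>This is the image of \<open>\<phi> v\<close> in the double dual. Its membership
    there has to be proved, since \<open>dual_map\<close> is precomposition only on that space and 0
    elsewhere.\<close>
  let ?\<beta> = "(\<chi> ?t / \<theta> ?t ?t) *\<^sub>C ext0 (dual V) (\<lambda>\<alpha>. \<alpha> y)"
  have \<beta>_apply: "?\<beta> \<alpha> = (if \<alpha> \<in> dual V then \<chi> ?t / \<theta> ?t ?t * \<alpha> y else 0)" for \<alpha>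
    by (simp add: scaleC_fun_apply scaleC_complex_def ext0_def)
  have \<beta>: "?\<beta> \<in> dual (dual V)"
    unfolding dual_def[of "dual V"] lin_maps_def mem_Collect_eq \<beta>_apply
    by (auto simp: scaleC_fun_apply scaleC_complex_def distrib_left complex_vector.subspace_add
        complex_vector.subspace_scale subspace_dual)
  have "\<iota> C v = dual_map (dual V) C ?\<beta>"
    using x y by (simp add: iota_def Let_def scaleC_fun_def ev_def lin_inv_def ext0_def cong: if_cong
          flip: y_def)
  also have "\<dots> = ?\<beta> \<circ> C"
    using \<beta> by (simp add: dual_map_def ext0_def)
  finally have 1: "\<iota> C v w = \<chi> ?t / \<theta> ?t ?t * C w y"
    by (simp add: scaleC_fun_def scaleC_complex_def ext0_def bil_dual[OF C])
  have "C w (\<rho> (s \<otimes> s) ?x) = \<theta> (s \<otimes> s) (?t \<otimes> ?t) * C w y"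
    unfolding sx using y by (simp add: bilD(4)[OF C])
  then have "\<chi> ?t * \<theta> s s * C w (\<rho> (s \<otimes> s) ?x) * \<theta> ?t ?t =
    \<chi> ?t * C w y * (\<theta> s s * \<theta> ?t ?t * \<theta> (s \<otimes> s) (?t \<otimes> ?t))"
    by (simp only: mult_ac)
  then have "\<chi> ?t * \<theta> s s * C w (\<rho> (s \<otimes> s) ?x) * \<theta> ?t ?t = \<chi> ?t * C w y"
    unfolding \<theta>_square_inv[OF s] by simp
  then show ?thesis
    unfolding 1 using \<theta>_nonzero[of ?t ?t] s by (auto simp: eq_divide_eq divide_eq_eq)
qed

text \<open>Because \<open>\<iota>\<close> swaps the arguments, invariance of
  \<open>\<iota> C\<close> under \<open>g\<close> comes from invariance of \<open>C\<close> under
  \<open>cj g\<close>. The second argument is then moved by \<open>cj (cj g)\<close>, which passes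
  through \<open>s \<otimes> s\<close> to become \<open>g\<close>, and \<open>\<phi>\<close>
  commutes with \<open>\<rho> g\<close>.\<close>

lemma iota_H:
  assumes C: "C \<in> H" shows "\<iota> C \<in> H"
proof -
  note b = H_bil[OF C]
  note l = lin_mapsD(2,3)[OF \<rho>_lin[OF ss_K(1)]] lin_mapsD(2,3)[OF \<phi>_lin]
  have z: "\<rho> (s \<otimes> s) (\<phi> v) = 0" if "v \<notin> V" for v
    using that lin_mapsD(4)[OF \<phi>_lin that] lin_maps_0[OF \<rho>_lin[OF ss_K(1)] V_subspace] by simp
  have "C v 0 = 0" for v
    using bilD(4)[OF b, of 0 v 0] complex_vector.subspace_0[OF V_subspace] by simp
  then have "\<iota> C \<in> bil"
    unfolding bilin_maps_iff[OF V_subspace] iota_eq[OF b]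
    by (auto simp: l bilD[OF b] \<phi>_closed \<rho>_closed ss_K z algebra_simps)
  moreover have "wt g * \<iota> C (\<rho> g v) (\<rho> (cj g) w) = \<iota> C v w"
    if g: "g \<in> K" and v: "v \<in> V" and w: "w \<in> V" for g v w
  proof -
    let ?h = "cj g" and ?m = "cj (cj g)" and ?x = "\<phi> v" and ?\<kappa> = "\<chi> (inv s) * \<theta> s s"
    have c: "g \<in> carrier Gh" "?h \<in> K" "?m \<in> K" "?h \<in> carrier Gh" "?m \<in> carrier Gh"
      using g cj_K K_closed(1) by auto
    have "?m \<otimes> (s \<otimes> s) = (s \<otimes> ?h) \<otimes> s" using c s by (simp add: cj_s flip: m_assoc)
    also have "\<dots> = s \<otimes> (?h \<otimes> s)" using c s by (simp add: m_assoc)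
    also have "\<dots> = (s \<otimes> s) \<otimes> g" using c s by (simp add: cj_s m_assoc)
    finally have m: "?m \<otimes> (s \<otimes> s) = (s \<otimes> s) \<otimes> g" .
    \<comment> \<open>Both orders of multiplication give multiples of the operator at
      \<open>(s \<otimes> s) \<otimes> g\<close>. The comparison stays cross-multiplied until
      \<open>wt_cj\<close> has been applied.\<close>
    have "\<rho> ?m (\<rho> (s \<otimes> s) ?x) = \<theta> ?m (s \<otimes> s) *\<^sub>C \<rho> ((s \<otimes> s) \<otimes> g) ?x"
      using \<rho>_mult[OF c(3) ss_K(1)] by (simp add: m)
    then have "\<theta> ?m (s \<otimes> s) * C (\<rho> ?h w) (\<rho> (s \<otimes> s) (\<rho> g ?x)) =
        \<theta> (s \<otimes> s) g * C (\<rho> ?h w) (\<rho> ?m (\<rho> (s \<otimes> s) ?x))"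
      using g ss_K by (simp add: \<rho>_mult bilD(4)[OF b] \<rho>_closed K_closed)
    then have "\<theta> ?m (s \<otimes> s) * (wt g * C (\<rho> ?h w) (\<rho> (s \<otimes> s) (\<rho> g ?x))) =
        (wt g * \<theta> (s \<otimes> s) g) * C (\<rho> ?h w) (\<rho> ?m (\<rho> (s \<otimes> s) ?x))"
      by (simp add: mult_ac)
    also have "\<dots> = \<theta> ?m (s \<otimes> s) * (wt ?h * C (\<rho> ?h w) (\<rho> ?m (\<rho> (s \<otimes> s) ?x)))"
      unfolding wt_cj[OF g] by (simp only: mult_ac)
    also have "\<dots> = \<theta> ?m (s \<otimes> s) * C w (\<rho> (s \<otimes> s) ?x)"
      using H_invariant[OF C c(2) w \<rho>_closed[OF ss_K(1)]] by simp
    finally have "wt g * C (\<rho> ?h w) (\<rho> (s \<otimes> s) (\<rho> g ?x)) = C w (\<rho> (s \<otimes> s) ?x)"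
      using \<theta>_nonzero[of ?m "s \<otimes> s"] c s by simp
    then have "?\<kappa> * (wt g * C (\<rho> ?h w) (\<rho> (s \<otimes> s) (\<rho> g ?x))) = ?\<kappa> * C w (\<rho> (s \<otimes> s) ?x)"
      by simp
    then show ?thesis
      unfolding iota_eq[OF b] \<phi>_commute[OF g] by (simp add: mult_ac)
  qed
  ultimately show ?thesis unfolding H_iff by blast
qed

lemma iota_linear:
  assumes "C \<in> H" "D \<in> H"
  shows "\<iota> (C + D) = \<iota> C + \<iota> D" "\<iota> (c *\<^sub>C C) = c *\<^sub>C \<iota> C"
proof -
  have "C + D \<in> bil" "c *\<^sub>C C \<in> bil"
    using assms H_bil complex_vector.subspace_add[OF H_subspace] complex_vector.subspace_scale[OF H_subspace]
    by blast+
  then show "\<iota> (C + D) = \<iota> C + \<iota> D" "\<iota> (c *\<^sub>C C) = c *\<^sub>C \<iota> C"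
    using assms[THEN H_bil]
    by (auto simp: fun_eq_iff iota_eq scaleC_fun_def scaleC_complex_def algebra_simps)
qed

section \<open>The averaging projection onto the invariant forms\<close>

definition avg :: "('v \<Rightarrow> 'v \<Rightarrow> complex) \<Rightarrow> 'v \<Rightarrow> 'v \<Rightarrow> complex" where
  "avg C v w = (\<Sum>g\<in>K. wt g * C (\<rho> g v) (\<rho> (cj g) w)) / of_nat (card K)"

lemma finite_K: "finite K"
  using finite_carrier by (rule rev_finite_subset) (auto simp: K_iff)

lemma card_K: "card K \<noteq> 0"
  using finite_K K_iff[of \<one>] \<pi>_one by auto

text \<open>Acting by \<open>x\<close> on the average only translates the summation index from
  \<open>g\<close> to \<open>g \<otimes> x\<close>, since \<open>wt_mult\<close> absorbs both
  multipliers.\<close>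

lemma avg_H:
  assumes C: "C \<in> bil" shows "avg C \<in> H"
proof -
  have z: "C 0 w = 0" "C v 0 = 0" for v w
    using bilD(2)[OF C, of 0 0 w] bilD(4)[OF C, of 0 v 0] complex_vector.subspace_0[OF V_subspace] by auto
  have "avg C \<in> bil"
    unfolding bilin_maps_iff[OF V_subspace] avg_def
  proof (intro conjI ballI allI impI)
    fix x y w assume "x \<in> V" "y \<in> V"
    then show "(\<Sum>g\<in>K. wt g * C (\<rho> g (x + y)) (\<rho> (cj g) w)) / of_nat (card K) =
      (\<Sum>g\<in>K. wt g * C (\<rho> g x) (\<rho> (cj g) w)) / of_nat (card K) +
      (\<Sum>g\<in>K. wt g * C (\<rho> g y) (\<rho> (cj g) w)) / of_nat (card K)"
      and "(\<Sum>g\<in>K. wt g * C (\<rho> g w) (\<rho> (cj g) (x + y))) / of_nat (card K) =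
      (\<Sum>g\<in>K. wt g * C (\<rho> g w) (\<rho> (cj g) x)) / of_nat (card K) +
      (\<Sum>g\<in>K. wt g * C (\<rho> g w) (\<rho> (cj g) y)) / of_nat (card K)"
      by (simp_all add: lin_mapsD(2)[OF \<rho>_lin] cj_K bilD(1,3)[OF C] \<rho>_closed distrib_left
          sum.distrib add_divide_distrib)
  next
    fix c x w assume "x \<in> V"
    then show "(\<Sum>g\<in>K. wt g * C (\<rho> g (c *\<^sub>C x)) (\<rho> (cj g) w)) / of_nat (card K) =
      c * ((\<Sum>g\<in>K. wt g * C (\<rho> g x) (\<rho> (cj g) w)) / of_nat (card K))"
      and "(\<Sum>g\<in>K. wt g * C (\<rho> g w) (\<rho> (cj g) (c *\<^sub>C x))) / of_nat (card K) =
      c * ((\<Sum>g\<in>K. wt g * C (\<rho> g w) (\<rho> (cj g) x)) / of_nat (card K))"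
      by (simp_all add: lin_mapsD(3)[OF \<rho>_lin] cj_K bilD(2,4)[OF C] \<rho>_closed sum_distrib_left mult_ac)
  next
    fix v w assume "v \<notin> V \<or> w \<notin> V"
    then have "C (\<rho> g v) (\<rho> (cj g) w) = 0" if "g \<in> K" for g
      using that lin_mapsD(4)[OF \<rho>_lin[of g], of v] lin_mapsD(4)[OF \<rho>_lin[of "cj g"], of w] z cj_K by auto
    then show "(\<Sum>g\<in>K. wt g * C (\<rho> g v) (\<rho> (cj g) w)) / of_nat (card K) = 0"
      by simp
  qed
  moreover have "wt x * avg C (\<rho> x v) (\<rho> (cj x) w) = avg C v w" if x: "x \<in> K" for x v w
  proof -
    have "wt x * (wt g * C (\<rho> g (\<rho> x v)) (\<rho> (cj g) (\<rho> (cj x) w))) =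
       wt (g \<otimes> x) * C (\<rho> (g \<otimes> x) v) (\<rho> (cj (g \<otimes> x)) w)" if g: "g \<in> K" for g
    proof -
      have k: "cj g \<in> K" "cj x \<in> K" "g \<otimes> x \<in> K" "cj g \<otimes> cj x \<in> K"
        using g x by (auto simp: cj_K K_closed)
      have "C (\<rho> g (\<rho> x v)) (\<rho> (cj g) (\<rho> (cj x) w)) =
          \<theta> g x * \<theta> (cj g) (cj x) * C (\<rho> (g \<otimes> x) v) (\<rho> (cj (g \<otimes> x)) w)"
        using g x k by (simp add: \<rho>_mult bilD(2,4)[OF C] \<rho>_closed cj_mult K_closed(1))
      then show ?thesis
        by (simp add: mult_ac flip: wt_mult[OF g x])
    qed
    then have "(\<Sum>g\<in>K. wt x * (wt g * C (\<rho> g (\<rho> x v)) (\<rho> (cj g) (\<rho> (cj x) w)))) =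
        (\<Sum>g\<in>K. wt (g \<otimes> x) * C (\<rho> (g \<otimes> x) v) (\<rho> (cj (g \<otimes> x)) w))"
      by simp
    also have "\<dots> = (\<Sum>g\<in>K. wt g * C (\<rho> g v) (\<rho> (cj g) w))"
      by (rule sum.reindex_bij_witness[where i = "\<lambda>g. g \<otimes> inv x" and j = "\<lambda>g. g \<otimes> x"])
        (use x in \<open>auto simp: K_closed m_assoc\<close>)
    finally show ?thesis by (simp add: avg_def sum_distrib_left)
  qed
  ultimately show ?thesis unfolding H_iff by blast
qed

lemma avg_id:
  assumes C: "C \<in> H" shows "avg C = C"
proof (intro ext)
  fix v w
  show "avg C v w = C v w"
  proof (cases "v \<in> V \<and> w \<in> V")
    case True
    then show ?thesis using card_K by (simp add: avg_def H_invariant[OF C])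
  next
    case False
    then show ?thesis
      using bilD(5,6)[OF H_bil[OF C]] bilD(5,6)[OF H_bil[OF avg_H[OF H_bil[OF C]]]] by auto
  qed
qed

text \<open>An invariant form equals its own average, so averaging its expansion in elementary forms
  gives a frame for \<open>H\<close>: the vectors are the averaged elementary forms, the functionals
  are the entries of the form in a basis of \<open>V\<close>.\<close>

lemma lin_trace_H:
  "lin_trace H \<iota> = (\<Sum>g\<in>K. \<chi> (inv (g \<otimes> s)) * \<theta> (g \<otimes> s) (g \<otimes> s) *
     lin_trace V (\<phi> \<circ> \<rho> ((g \<otimes> s) \<otimes> (g \<otimes> s)))) / of_nat (card K)"
proof -
  obtain B where B: "finite B" "complex_vector.independent B" "complex_vector.span B = V"
    using fin_dim_space_basis[OF V_fin_dim] .
  have BV: "b \<in> V" if "b \<in> B" for b using that B(3) complex_vector.span_base by auto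
  define R where "R b v = complex_vector.representation B v b" for b v
  have R_add: "R b (v + w) = R b v + R b w" if "v \<in> V" "w \<in> V" for b v w
    using that B by (simp add: R_def complex_vector.representation_add)
  have R_scale: "R b (c *\<^sub>C v) = c * R b v" if "v \<in> V" for b c v
    using that B by (simp add: R_def complex_vector.representation_scale)
  \<comment> \<open>Outside the span of the basis \<open>representation\<close> takes the default
    value 0, so coordinates are already extended by zero.\<close>
  have R_out: "R b v = 0" if "v \<notin> V" for b v
    using that B by (simp add: R_def complex_vector.representation_def)
  have R_sum: "(\<Sum>b\<in>B. R b v *\<^sub>C b) = v" if "v \<in> V" for v
    using that B by (simp add: R_def complex_vector.sum_representation_eq)
  define E where "E k v w = R (fst k) v * R (snd k) w" for k v w
  have E: "E k \<in> bil" for k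
    unfolding bilin_maps_iff[OF V_subspace] by (auto simp: E_def R_add R_scale R_out algebra_simps)
  have expand: "C v w = (\<Sum>k\<in>B \<times> B. C (fst k) (snd k) * E k v w)" if C: "C \<in> bil" for C v w
  proof (cases "v \<in> V \<and> w \<in> V")
    case True
    have "C v w = C (\<Sum>i\<in>B. R i v *\<^sub>C i) w"
      using True R_sum by simp
    also have "\<dots> = (\<Sum>i\<in>B. R i v *\<^sub>C C i w)"
      by (rule linear_on_sum[OF V_subspace, where f = "\<lambda>v. C v w"])
        (simp_all add: bilD[OF C] BV scaleC_complex_def)
    also have "\<dots> = (\<Sum>i\<in>B. R i v *\<^sub>C C i (\<Sum>j\<in>B. R j w *\<^sub>C j))"
      using True R_sum by simp
    also have "\<dots> = (\<Sum>i\<in>B. R i v *\<^sub>C (\<Sum>j\<in>B. R j w *\<^sub>C C i j))"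
      by (subst linear_on_sum[OF V_subspace]) (simp_all add: bilD[OF C] BV scaleC_complex_def)
    also have "\<dots> = (\<Sum>k\<in>B \<times> B. C (fst k) (snd k) * E k v w)"
      by (simp add: scaleC_complex_def sum_distrib_left E_def mult_ac sum.cartesian_product
          case_prod_unfold)
    finally show ?thesis .
  next
    case False
    then show ?thesis using bilD(5,6)[OF C] by (auto simp: E_def R_out)
  qed
  have frame: "y = (\<Sum>k\<in>B \<times> B. y (fst k) (snd k) *\<^sub>C avg (E k))" if y: "y \<in> H" for y
  proof (intro ext)
    fix v w
    have "y v w = avg y v w" using avg_id[OF y] by simp
    also have "\<dots> = (\<Sum>g\<in>K. wt g * (\<Sum>k\<in>B \<times> B. y (fst k) (snd k) * E k (\<rho> g v) (\<rho> (cj g) w)))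
        / of_nat (card K)"
      unfolding avg_def by (subst expand[OF H_bil[OF y]]) (rule refl)
    also have "\<dots> = (\<Sum>k\<in>B \<times> B. y (fst k) (snd k) * avg (E k) v w)"
      unfolding sum_distrib_left avg_def sum_divide_distrib
      by (subst sum.swap) (simp add: mult_ac)
    also have "\<dots> = (\<Sum>k\<in>B \<times> B. y (fst k) (snd k) *\<^sub>C avg (E k)) v w"
      by (simp add: sum_fun_apply scaleC_fun_def scaleC_complex_def)
    finally show "y v w = (\<Sum>k\<in>B \<times> B. y (fst k) (snd k) *\<^sub>C avg (E k)) v w" .
  qed
  let ?\<kappa> = "\<chi> (inv s) * \<theta> s s"
  have "lin_trace H \<iota> = (\<Sum>k\<in>B \<times> B. \<iota> (avg (E k)) (fst k) (snd k))"
  proof (rule lin_trace_frame[where \<xi> = "\<lambda>k y. y (fst k) (snd k)" and x = "\<lambda>k. avg (E k)"])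
    show "\<And>C D. C \<in> H \<Longrightarrow> D \<in> H \<Longrightarrow> \<iota> (C + D) = \<iota> C + \<iota> D"
      by (rule iota_linear)
    show "\<And>c C. C \<in> H \<Longrightarrow> \<iota> (c *\<^sub>C C) = c *\<^sub>C \<iota> C"
      by (rule iota_linear)
    show "\<And>y. y \<in> H \<Longrightarrow> y = (\<Sum>k\<in>B \<times> B. y (fst k) (snd k) *\<^sub>C avg (E k))"
      by (rule frame)
  qed (use B(1) in \<open>simp_all only: H_subspace avg_H[OF E] iota_H scaleC_fun_apply scaleC_complex_def
        plus_fun_apply finite_cartesian_product\<close>)
  \<comment> \<open>The swap of arguments in \<open>\<iota>\<close> pairs the coordinate
    \<open>fst k\<close> with the vector \<open>snd k\<close> and vice versa, so the double sum
    below is the trace of a product of operators.\<close>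
  also have "\<dots> = (\<Sum>k\<in>B \<times> B. ?\<kappa> * avg (E k) (snd k) (\<rho> (s \<otimes> s) (\<phi> (fst k))))"
    by (simp only: iota_eq[OF H_bil[OF avg_H[OF E]]])
  also have "\<dots> = (\<Sum>k\<in>B \<times> B. \<Sum>g\<in>K. ?\<kappa> * wt g *
      (R (fst k) (\<rho> g (snd k)) * R (snd k) (\<rho> (cj g) (\<rho> (s \<otimes> s) (\<phi> (fst k))))) / of_nat (card K))"
    by (simp add: avg_def E_def sum_distrib_left sum_divide_distrib mult_ac)
  also have "\<dots> = (\<Sum>g\<in>K. ?\<kappa> * wt g * (\<Sum>i\<in>B. \<Sum>j\<in>B.
      R i (\<rho> g j) * R j (\<rho> (cj g) (\<rho> (s \<otimes> s) (\<phi> i)))) / of_nat (card K))"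
    by (subst sum.swap) (simp add: sum_distrib_left sum_divide_distrib sum.cartesian_product case_prod_unfold)
  also have "\<dots> = (\<Sum>g\<in>K. \<chi> (inv (g \<otimes> s)) * \<theta> (g \<otimes> s) (g \<otimes> s) *
     lin_trace V (\<phi> \<circ> \<rho> ((g \<otimes> s) \<otimes> (g \<otimes> s))) / of_nat (card K))"
  proof (rule sum.cong[OF refl])
    fix g assume g: "g \<in> K"
    let ?u = "g \<otimes> s" and ?h = "cj g"
    have c: "g \<in> carrier Gh" "?h \<in> carrier Gh" "?h \<in> K" "g \<otimes> ?h \<in> K"
      using g by (auto simp: cj_K K_closed)
    have u: "?u \<otimes> ?u = (g \<otimes> ?h) \<otimes> (s \<otimes> s)" "?u \<otimes> ?u \<in> K"
      using square_mult_s[OF c(1)] c ss_K by (auto simp: K_closed(3))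
    \<comment> \<open>Summing over \<open>j\<close> is matrix multiplication; the three operators
      then merge into one at the square of \<open>g \<otimes> s\<close>, at the cost of two
      multipliers.\<close>
    have "(\<Sum>j\<in>B. R i (\<rho> g j) * R j (\<rho> ?h (\<rho> (s \<otimes> s) (\<phi> i)))) =
        \<theta> g ?h * \<theta> (g \<otimes> ?h) (s \<otimes> s) * R i (\<phi> (\<rho> (?u \<otimes> ?u) i))" for i
    proof -
      let ?x = "\<rho> ?h (\<rho> (s \<otimes> s) (\<phi> i))"
      have x: "?x \<in> V" using c by (simp add: \<rho>_closed)
      have "\<rho> g ?x = \<rho> g (\<Sum>j\<in>B. R j ?x *\<^sub>C j)" using R_sum[OF x] by simp
      also have "\<dots> = (\<Sum>j\<in>B. R j ?x *\<^sub>C \<rho> g j)"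
        by (rule linear_on_sum[OF V_subspace]) (simp_all add: lin_mapsD[OF \<rho>_lin[OF g]] BV)
      finally have "R i (\<rho> g ?x) = R i (\<Sum>j\<in>B. R j ?x *\<^sub>C \<rho> g j)" by simp
      also have "\<dots> = (\<Sum>j\<in>B. R j ?x *\<^sub>C R i (\<rho> g j))"
        by (rule linear_on_sum[OF V_subspace]) (simp_all add: R_add R_scale \<rho>_closed[OF g] scaleC_complex_def)
      finally have "(\<Sum>j\<in>B. R i (\<rho> g j) * R j ?x) = R i (\<rho> g ?x)"
        by (simp add: scaleC_complex_def mult_ac)
      also have "\<rho> g ?x = \<theta> g ?h *\<^sub>C \<theta> (g \<otimes> ?h) (s \<otimes> s) *\<^sub>C \<rho> (?u \<otimes> ?u) (\<phi> i)"
        unfolding u by (simp only: \<rho>_mult[OF g c(3)] \<rho>_mult[OF c(4) ss_K(1)])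
      also have "R i \<dots> = \<theta> g ?h * \<theta> (g \<otimes> ?h) (s \<otimes> s) * R i (\<phi> (\<rho> (?u \<otimes> ?u) i))"
        using u(2) by (simp add: R_scale \<rho>_closed complex_vector.subspace_scale[OF V_subspace] \<phi>_commute
            scaleC_scaleC)
      finally show ?thesis .
    qed
    then have "(\<Sum>i\<in>B. \<Sum>j\<in>B. R i (\<rho> g j) * R j (\<rho> ?h (\<rho> (s \<otimes> s) (\<phi> i)))) =
        \<theta> g ?h * \<theta> (g \<otimes> ?h) (s \<otimes> s) * (\<Sum>i\<in>B. R i (\<phi> (\<rho> (?u \<otimes> ?u) i)))"
      by (simp add: sum_distrib_left)
    also have "(\<Sum>i\<in>B. R i (\<phi> (\<rho> (?u \<otimes> ?u) i))) = lin_trace V (\<phi> \<circ> \<rho> (?u \<otimes> ?u))"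
      using lin_trace_representation[OF B lin_maps_comp[OF \<rho>_lin[OF u(2)] \<phi>_lin V_subspace]]
      by (simp add: R_def)
    finally show "?\<kappa> * wt g * (\<Sum>i\<in>B. \<Sum>j\<in>B. R i (\<rho> g j) * R j (\<rho> ?h (\<rho> (s \<otimes> s) (\<phi> i)))) /
        of_nat (card K) =
      \<chi> (inv ?u) * \<theta> ?u ?u * lin_trace V (\<phi> \<circ> \<rho> (?u \<otimes> ?u)) / of_nat (card K)"
      unfolding \<theta>_square_mult_s[OF g]
      using c s by (simp add: \<chi>_inv \<chi>_mult \<chi>_nonzero)
  qed
  finally show ?thesis by (simp add: sum_divide_distrib)
qed

section \<open>Evaluation of the pairing\<close>

lemma tau_elt_apply:
  "tau_elt (ker_group Gh \<pi>) (V, \<rho>) \<phi> g = (if g \<in> K then lin_trace V (\<phi> \<circ> \<rho> g) else 0)"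
proof -
  have "tau_elt (ker_group Gh \<pi>) (V, \<rho>) \<phi> g = (\<Sum>h\<in>K. if h = g then lin_trace V (\<phi> \<circ> \<rho> h) else 0)"
    by (auto simp: sum_fun_apply ker_group_def scaleC_fun_def scaleC_complex_def basis_elt_def
        intro!: sum.cong)
  then show ?thesis by (simp add: finite_K)
qed

lemma trace_eq_pairing:
  "lin_trace H \<iota> = pairing (ker_group Gh \<pi>) \<theta> (tau_elt (ker_group Gh \<pi>) (V, \<rho>) \<phi>) (nu_elt Gh \<pi> \<theta> \<chi>)"
proof -
  let ?O = "carrier Gh - K"
  let ?tr = "\<lambda>g. lin_trace V (\<phi> \<circ> \<rho> g)"
  have O: "u \<in> ?O \<longleftrightarrow> u \<in> carrier Gh \<and> \<pi> u = -1" for u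
    using \<pi>_cases[of u] by (auto simp: K_iff)
  have finO: "finite ?O" using finite_carrier by simp
  have sqK: "u \<otimes> u \<in> K" if "u \<in> ?O" for u
    using that unfolding O by (simp add: K_iff \<pi>_mult)
  have nu: "nu_elt Gh \<pi> \<theta> \<chi> g = (\<Sum>u\<in>?O. if u \<otimes> u = g then \<chi> u / \<theta> u u else 0)" for g
    by (auto simp: nu_elt_def sum_fun_apply ker_group_def scaleC_fun_def scaleC_complex_def basis_elt_def
        intro!: sum.cong)
  have "pairing (ker_group Gh \<pi>) \<theta> (tau_elt (ker_group Gh \<pi>) (V, \<rho>) \<phi>) (nu_elt Gh \<pi> \<theta> \<chi>) =
      (\<Sum>g\<in>K. inverse (\<theta> (inv g) g) * ?tr (inv g) * nu_elt Gh \<pi> \<theta> \<chi> g) / of_nat (card K)"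
    unfolding pairing_def tau_elt_apply
    by (simp add: ker_group_def inv_K K_closed)
  \<comment> \<open>The coefficient of \<open>nu_elt\<close> at \<open>g\<close> is a sum over odd
    square roots of \<open>g\<close>; after exchanging the sums, only
    \<open>g = u \<otimes> u\<close> survives for each odd \<open>u\<close>.\<close>
  also have "(\<Sum>g\<in>K. inverse (\<theta> (inv g) g) * ?tr (inv g) * nu_elt Gh \<pi> \<theta> \<chi> g) =
      (\<Sum>u\<in>?O. \<Sum>g\<in>K. if u \<otimes> u = g then inverse (\<theta> (inv g) g) * ?tr (inv g) * (\<chi> u / \<theta> u u) else 0)"
    unfolding nu sum_distrib_left by (subst sum.swap) (auto intro!: sum.cong)
  also have "\<dots> = (\<Sum>u\<in>?O. inverse (\<theta> (inv (u \<otimes> u)) (u \<otimes> u)) * ?tr (inv (u \<otimes> u)) * (\<chi> u / \<theta> u u))"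
    by (rule sum.cong[OF refl]) (simp add: finite_K sqK)
  also have "\<dots> = (\<Sum>u\<in>?O. \<chi> (inv u) * \<theta> u u * ?tr (u \<otimes> u))"
  \<comment> \<open>The pairing evaluates the trace at inverses, so \<open>u\<close> is replaced by
    \<open>inv u\<close>, and \<open>\<theta>_square_inv\<close> converts the scalars.\<close>
  proof (rule sum.reindex_bij_witness[where i = "m_inv Gh" and j = "m_inv Gh"])
    fix u assume u: "u \<in> ?O"
    have c: "u \<in> carrier Gh" "\<pi> (inv u) = -1" "inv u \<in> carrier Gh" using u unfolding O by (auto simp: \<pi>_inv)
    have i: "inv (u \<otimes> u) = inv u \<otimes> inv u" using c by (simp add: inv_mult_group)
    have "\<theta> (inv u) (inv u) * \<theta> u u * \<theta> (inv u \<otimes> inv u) (u \<otimes> u) = 1"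
      using \<theta>_square_inv[of "inv u"] c by simp
    then have "\<theta> (inv u) (inv u) = inverse (\<theta> (inv u \<otimes> inv u) (u \<otimes> u)) * (1 / \<theta> u u)"
      using \<theta>_nonzero[of u u] \<theta>_nonzero[of "inv u \<otimes> inv u" "u \<otimes> u"] c by (simp add: field_simps)
    then show "\<chi> (inv (inv u)) * \<theta> (inv u) (inv u) * ?tr (inv u \<otimes> inv u) =
        inverse (\<theta> (inv (u \<otimes> u)) (u \<otimes> u)) * ?tr (inv (u \<otimes> u)) * (\<chi> u / \<theta> u u)"
      using c by (simp add: i)
  qed (unfold O, auto simp: \<pi>_inv)
  also have "\<dots> = (\<Sum>g\<in>K. \<chi> (inv (g \<otimes> s)) * \<theta> (g \<otimes> s) (g \<otimes> s) * ?tr ((g \<otimes> s) \<otimes> (g \<otimes> s)))"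
    \<comment> \<open>The odd elements form the single coset of \<open>K\<close> through
      \<open>s\<close>.\<close>
    by (rule sum.reindex_bij_witness[where i = "\<lambda>g. g \<otimes> s" and j = "\<lambda>u. u \<otimes> inv s"])
      (unfold O K_iff, use s in \<open>auto simp: \<pi>_mult \<pi>_inv m_assoc\<close>)
  finally show ?thesis unfolding lin_trace_H by simp
qed

end

theorem theorem2p7:
  fixes Gh :: "('g, 'm) monoid_scheme" and G :: "('g, 'm) monoid_scheme"
    and \<pi> :: "'g \<Rightarrow> int" and \<theta> :: "'g \<Rightarrow> 'g \<Rightarrow> complex" and \<chi> :: "'g \<Rightarrow> complex" and s :: 'g
    and V :: "'v::complex_vector set" and \<rho> :: "'g \<Rightarrow> 'v \<Rightarrow> 'v" and \<phi> :: "'v \<Rightarrow> 'v"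
  assumes "group Gh" and "finite (carrier Gh)"
    and "\<pi> \<in> hom Gh C2" and "\<pi> ` carrier Gh = carrier C2"
    and "G = ker_group Gh \<pi>"
    and "twisted_cocycle Gh \<pi> \<theta>"
    and "\<chi> \<in> hom Gh U1"
    and "s \<in> carrier Gh - carrier G"
    and "twisted_rep G \<theta> (V, \<rho>)"
    and "\<phi> \<in> rep_hom G (V, \<rho>) (V, \<rho>)"
  shows "lin_trace (rep_hom G (V, \<rho>) (dual_rep Gh \<pi> \<theta> \<chi> s (V, \<rho>))) (iota Gh \<theta> \<chi> s (V, \<rho>) \<phi>) =
         pairing G \<theta> (tau_elt G (V, \<rho>) \<phi>) (nu_elt Gh \<pi> \<theta> \<chi>)"
proof -
  interpret group Gh by fact
  have "\<pi> s = -1"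
    using assms(3,5,8) hom_in_carrier[of \<pi> Gh C2 s] by (auto simp: ker_group_def kernel_def C2_def)
  then interpret twisted_extension_rep Gh \<pi> \<theta> \<chi> s V \<rho> \<phi>
    using assms by unfold_locales auto
  show ?thesis
    unfolding \<open>G = ker_group Gh \<pi>\<close> by (rule trace_eq_pairing)
qed

end
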